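(* Let $d\ge 2$ be an integer. For every $p\in\mathbb{R}$, every $f\in C_c^\infty(\mathbb{R}^{d-1}\times(0,\infty))$ and every $(x,y)\in\mathbb{R}^{d-1}\times(0,\infty)$, both of the following formulas hold: $$f(x,y)=\frac{y^{p}}{(2\pi)^{d-1}}\int_0^{\pi/2}\frac{1}{(\cos\theta)^{1+p}}\int_{S^{d-2}}\bigl(I^{(1-d)}R^{(p)}f\bigr)\bigl(x+y\tan(\theta)\,n,\ \theta\bigr)\,dn\,d\theta,$$ $$f(x,y)=\frac{1}{(2\pi)^{d-1}}\int_{\mathbb{R}^{d-1}}\frac{\bigl(|u-x|^2+y^2\bigr)^{\frac{p-1}{2}}}{|u-x|^{d-2}}\ \bigl(I^{(1-d)}R^{(p)}f\bigr)\Bigl(u,\ \arctan\Bigl(\frac{|u-x|}{y}\Bigr)\Bigr)\,du .$$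
   Context: Points of $\mathbb{R}^d$ are written $(x,y)$ with $x\in\mathbb{R}^{d-1}$, $y\in\mathbb{R}$. $C_c^\infty(\mathbb{R}^{d-1}\times(0,\infty))$ is the space of real-valued $C^\infty$ functions on $\mathbb{R}^d$ with compact support contained in $\mathbb{R}^{d-1}\times(0,\infty)$. $S^{d-2}$ is the unit sphere in $\mathbb{R}^{d-1}$ and $dn$ its surface measure (for $d=2$, $S^0=\{-1,1\}$ with counting measure). Conical Radon transform: for $p\in\mathbb{R}$, $u\in\mathbb{R}^{d-1}$, $\theta\in(0,\pi/2)$, $$(R^{(p)}f)(u,\theta)=\int_0^\infty\frac{1}{s^p}\int_{S^{d-2}}f\bigl(u+s\sin(\theta)\,n,\ s\cos(\theta)\bigr)\,(s\sin\theta)^{d-2}\,dn\,ds .$$ Fourier transform in the first argument: for $g:\mathbb{R}^{d-1}\times(0,\pi/2)\to\mathbb{C}$, $(Fg)(k,\theta)=\int_{\mathbb{R}^{d-1}}e^{-i k\cdot u}g(u,\theta)\,du$. Riesz potential: $I^{(1-d)}g:\mathbb{R}^{d-1}\times(0,\pi/2)\to\mathbb{C}$ is defined by $(F I^{(1-d)}g)(k,\theta)=|k|^{d-1}(Fg)(k,\theta)$ for $(k,\theta)\in\mathbb{R}^{d-1}\times(0,\pi/2)$, i.e. $(I^{(1-d)}g)(u,\theta)=(2\pi)^{-(d-1)}\int_{\mathbb{R}^{d-1}}|k|^{d-1}(Fg)(k,\theta)e^{ik\cdot u}\,dk$. *)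

theory Defs
  imports "HOL-Analysis.Analysis"
begin

text \<open>
  Throughout, a Euclidean space \<open>'a\<close> with \<open>DIM('a) = d - 1\<close> plays the role of
  \<open>\<real>\<^sup>d\<^sup>-\<^sup>1\<close>, and \<open>'a \<times> real\<close> that of \<open>\<real>\<^sup>d\<close>. As Euclidean spaces are nontrivial,
  \<open>d \<ge> 2\<close> is automatic.
\<close>

text \<open>\<open>C\<^sup>n\<close> functions, by recursion on the order through all directional derivatives.\<close>

primrec C_order :: "nat \<Rightarrow> ('a::real_normed_vector \<Rightarrow> 'b::real_normed_vector) \<Rightarrow> bool" where
  "C_order 0 f \<longleftrightarrow> continuous_on UNIV f"
| "C_order (Suc n) f \<longleftrightarrow>
     (\<forall>z. f differentiable (at z)) \<and> (\<forall>v. C_order n (\<lambda>z. frechet_derivative f (at z) v))"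

definition Cc_infinity_upper :: "('a::euclidean_space \<times> real \<Rightarrow> real) set" where
  "Cc_infinity_upper =
     {f. (\<forall>n. C_order n f) \<and> compact (closure {z. f z \<noteq> 0}) \<and>
         closure {z. f z \<noteq> 0} \<subseteq> UNIV \<times> {0<..}}"

text \<open>
  Surface measure of the unit sphere, as a Borel measure on the ambient space concentrated on
  the sphere: \<open>\<sigma>(A) = n \<cdot> vol {r w | w \<in> A, 0 < r < 1}\<close> with \<open>n\<close> the dimension. This is the
  measure occurring in integration in polar coordinates,
  \<open>\<integral> h(v) dv = \<integral>\<^sub>0\<^sup>\<infinity> r\<^sup>n\<^sup>-\<^sup>1 \<integral> h(r w) d\<sigma>(w) dr\<close>. In dimension 1 it is the counting measure
  on \<open>{-1, 1}\<close>. Note that \<open>sgn v = v / |v|\<close>.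
\<close>

definition sphere_measure :: "'a::euclidean_space measure" where
  "sphere_measure =
     scale_measure (of_nat DIM('a))
       (distr (restrict_space lborel (ball 0 1 - {0})) borel sgn)"

definition conical_radon ::
    "real \<Rightarrow> ('a::euclidean_space \<times> real \<Rightarrow> real) \<Rightarrow> 'a \<Rightarrow> real \<Rightarrow> real" where
  "conical_radon p f u \<theta> =
     (LINT s:{0<..}|lborel. 1 / s powr p *
        (LINT n|sphere_measure.
           f (u + (s * sin \<theta>) *\<^sub>R n, s * cos \<theta>) * (s * sin \<theta>) ^ (DIM('a) - 1)))"

definition fourier_fst ::
    "('a::euclidean_space \<Rightarrow> real \<Rightarrow> complex) \<Rightarrow> 'a \<Rightarrow> real \<Rightarrow> complex" where
  "fourier_fst g k \<theta> = (LINT u|lborel. exp (- \<i> * complex_of_real (k \<bullet> u)) * g u \<theta>)"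

text \<open>
  The Riesz potential \<open>I\<^sup>(\<^sup>1\<^sup>-\<^sup>d\<^sup>)\<close> in the first argument, that is, the Fourier multiplier
  \<open>|k|\<^sup>d\<^sup>-\<^sup>1\<close> where \<open>d - 1 = DIM('a)\<close>.
\<close>

definition riesz_potential ::
    "('a::euclidean_space \<Rightarrow> real \<Rightarrow> complex) \<Rightarrow> 'a \<Rightarrow> real \<Rightarrow> complex" where
  "riesz_potential g u \<theta> =
     complex_of_real (1 / (2 * pi) ^ DIM('a)) *
     (LINT k|lborel. complex_of_real (norm k ^ DIM('a)) * fourier_fst g k \<theta> *
        exp (\<i> * complex_of_real (k \<bullet> u)))"

definition riesz_conical ::
    "real \<Rightarrow> ('a::euclidean_space \<times> real \<Rightarrow> real) \<Rightarrow> 'a \<Rightarrow> real \<Rightarrow> complex" where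
  "riesz_conical p f = riesz_potential (\<lambda>u \<theta>. complex_of_real (conical_radon p f u \<theta>))"

end

theory Submission
  imports Defs "HOL-Probability.Characteristic_Functions" "HOL-Probability.Sinc_Integral"
begin

text \<open>
  Put \<open>m = d - 1\<close> and lift \<open>f\<close> to the function \<open>F (u, w) = |w|\<^sup>-\<^sup>p f (u, |w|)\<close> on
  \<open>\<real>\<^sup>m \<times> \<real>\<^sup>m\<close>. It is smooth with compact support, since \<open>f\<close> vanishes near \<open>y = 0\<close>, and
  invariant under rotations of \<open>w\<close>. Polar coordinates identify the integral of \<open>f\<close> over a cone
  with an integral of \<open>F\<close> over an affine subspace (\<open>conical_radon_eq_lift_integral\<close>):
  \<open>R f (u, \<theta>) = (cos \<theta>)\<^sup>p\<^sup>-\<^sup>1 (tan \<theta>)\<^sup>m\<^sup>-\<^sup>1 \<integral> F (u + tan \<theta> w, w) dw\<close>.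
  Hence the Fourier transform of \<open>R f\<close> in \<open>u\<close> is, up to the same prefactor, the restriction
  \<open>H (k, - tan \<theta> k)\<close> of the Fourier transform \<open>H\<close> of \<open>F\<close> (\<open>fourier_conical_radon\<close>).

  In the second formula put \<open>u = x + v\<close>. The weights cancel the prefactor up to a
  factor in \<open>y\<close> and \<open>\<pi>\<close>, and what remains is the double integral over \<open>k\<close> and \<open>v\<close> of
  \<open>|k|\<^sup>m cis (k \<bullet> (x + v)) H (k, - (|v| / y) k)\<close>. Since \<open>H\<close> is radial in its second argument, that
  argument may be replaced by \<open>|k| v / y\<close>, and the substitution \<open>v = y w / |k|\<close> absorbs the multiplier
  \<open>|k|\<^sup>m\<close> (\<open>kernel_substitution\<close>). The result is the integral of
  \<open>cis (k \<bullet> x + y e \<bullet> w) H (k, w)\<close> with \<open>e = k / |k|\<close>, and by radiality \<open>e\<close> may be taken to be any fixed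
  unit vector. This is the Fourier inversion integral of \<open>F\<close> at \<open>(x, y e)\<close>, where
  \<open>F (x, y e) = y\<^sup>-\<^sup>p f (x, y)\<close> (\<open>kernel_integral\<close>). The first formula is the second one in polar
  coordinates \<open>v = y tan \<theta> n\<close>.

  The exchange of the integrals over \<open>k\<close> and \<open>v\<close> and the Fourier inversion rest on \<open>H\<close> being
  integrable, which holds because derivatives of \<open>F\<close> of every order are again continuous with compact support (\<open>integrable_fourier\<close>). The general
  tools are polar coordinates for the given sphere measure, invariance of Lebesgue measure under
  reflections, and Fourier inversion.
\<close>

section \<open>Affine substitutions\<close>

lemma nn_integral_lborel_affine:
  fixes h :: "'a::euclidean_space \<Rightarrow> ennreal"
  assumes [measurable]: "h \<in> borel_measurable borel" and c: "c \<noteq> 0"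
  shows "(\<integral>\<^sup>+x. h x \<partial>lborel) = ennreal (\<bar>c\<bar> ^ DIM('a)) * (\<integral>\<^sup>+x. h (t + c *\<^sub>R x) \<partial>lborel)"
proof -
  have "(\<integral>\<^sup>+x. h x \<partial>lborel)
      = (\<integral>\<^sup>+x. h x \<partial>density (distr lborel borel (\<lambda>x. t + c *\<^sub>R x)) (\<lambda>_. \<bar>c\<bar> ^ DIM('a)))"
    by (subst lborel_affine[OF c, of t]) (rule refl)
  also have "\<dots> = ennreal (\<bar>c\<bar> ^ DIM('a)) * (\<integral>\<^sup>+x. h (t + c *\<^sub>R x) \<partial>lborel)"
    by (simp add: nn_integral_density nn_integral_distr nn_integral_cmult ennreal_power)
  finally show ?thesis .
qed

lemma lborel_integral_affine:
  fixes h :: "'a::euclidean_space \<Rightarrow> 'b::{banach, second_countable_topology}"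
  assumes [measurable]: "h \<in> borel_measurable borel" and c: "c \<noteq> 0"
  shows "integrable lborel (\<lambda>x. h (t + c *\<^sub>R x)) \<longleftrightarrow> integrable lborel h"
    and "(LINT x|lborel. h x) = \<bar>c\<bar> ^ DIM('a) *\<^sub>R (LINT x|lborel. h (t + c *\<^sub>R x))"
proof -
  let ?M = "density (distr lborel borel (\<lambda>x::'a. t + c *\<^sub>R x)) (\<lambda>_. ennreal (\<bar>c\<bar> ^ DIM('a)))"
  have M: "lborel = ?M" using lborel_affine[OF c, of t] by simp
  have "integrable lborel h \<longleftrightarrow> integrable ?M h" by (subst M) (rule refl)
  also have "\<dots> \<longleftrightarrow> integrable lborel (\<lambda>x. \<bar>c\<bar> ^ DIM('a) *\<^sub>R h (t + c *\<^sub>R x))"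
    using c by (subst integrable_density) (simp_all add: integrable_distr_eq)
  also have "\<dots> \<longleftrightarrow> integrable lborel (\<lambda>x. h (t + c *\<^sub>R x))"
    using c integrable_scaleR_right[of "inverse (\<bar>c\<bar> ^ DIM('a))" lborel "\<lambda>x. \<bar>c\<bar> ^ DIM('a) *\<^sub>R h (t + c *\<^sub>R x)"]
    by auto
  finally show "integrable lborel (\<lambda>x. h (t + c *\<^sub>R x)) \<longleftrightarrow> integrable lborel h" ..
  have "(LINT x|lborel. h x) = (LINT x|?M. h x)" by (subst M) (rule refl)
  also have "\<dots> = \<bar>c\<bar> ^ DIM('a) *\<^sub>R (LINT x|lborel. h (t + c *\<^sub>R x))"
    using c by (subst integral_density) (simp_all add: integral_distr)
  finally show "(LINT x|lborel. h x) = \<bar>c\<bar> ^ DIM('a) *\<^sub>R (LINT x|lborel. h (t + c *\<^sub>R x))" .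
qed

section \<open>Surface measure and polar coordinates\<close>

lemma borel_measurable_sgn_euclidean [measurable]:
  "(sgn :: 'a::euclidean_space \<Rightarrow> 'a) \<in> borel_measurable borel"
  unfolding sgn_div_norm[abs_def] by measurable

lemma sets_sphere_measure [simp, measurable_cong]: "sets sphere_measure = sets borel"
  by (simp add: sphere_measure_def)

lemma space_sphere_measure [simp]: "space sphere_measure = UNIV"
  by (simp add: sphere_measure_def space_scale_measure)

lemma nn_integral_sphere_measure:
  fixes g :: "'a::euclidean_space \<Rightarrow> ennreal"
  assumes [measurable]: "g \<in> borel_measurable borel"
  shows "(\<integral>\<^sup>+n. g n \<partial>sphere_measure)
    = of_nat DIM('a) * (\<integral>\<^sup>+w. g (sgn w) * indicator (ball 0 1 - {0}) w \<partial>lborel)"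
proof -
  have [measurable]: "sgn \<in> measurable (restrict_space lborel (ball 0 1 - {0})) (borel :: 'a measure)"
    by (rule measurable_restrict_space1) measurable
  show ?thesis
    unfolding sphere_measure_def
    by (subst nn_integral_scale_measure) (simp_all add: nn_integral_distr nn_integral_restrict_space)
qed

lemma finite_measure_sphere_measure: "finite_measure (sphere_measure :: 'a::euclidean_space measure)"
proof
  have "emeasure sphere_measure (space (sphere_measure :: 'a measure))
      = (\<integral>\<^sup>+n. 1 \<partial>(sphere_measure :: 'a measure))"
    by simp
  also have "\<dots> = of_nat DIM('a) * emeasure lborel (ball 0 1 - {0 :: 'a})"
    by (subst nn_integral_sphere_measure) simp_all
  also have "\<dots> < \<infinity>"
  proof -
    have "emeasure lborel (ball 0 1 - {0 :: 'a}) \<le> emeasure lborel (ball 0 1 :: 'a set)"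
      by (rule emeasure_mono) auto
    also have "\<dots> < \<infinity>" by (rule emeasure_bounded_finite) simp
    finally show ?thesis by (simp add: ennreal_mult_less_top of_nat_less_top)
  qed
  finally show "emeasure sphere_measure (space (sphere_measure :: 'a measure)) \<noteq> \<infinity>" by simp
qed

interpretation sphere_measure: finite_measure "sphere_measure :: 'a::euclidean_space measure"
  by (rule finite_measure_sphere_measure)

lemma AE_sphere_measure_norm: "AE n in (sphere_measure :: 'a::euclidean_space measure). norm n = 1"
proof (rule AE_I)
  let ?N = "{n :: 'a. norm n \<noteq> 1}"
  show "{n \<in> space sphere_measure. norm n \<noteq> 1} \<subseteq> ?N" by auto
  show "?N \<in> sets sphere_measure" by simp
  have "emeasure sphere_measure ?N = (\<integral>\<^sup>+n. indicator ?N n \<partial>sphere_measure)" by simp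
  also have "\<dots> = of_nat DIM('a) * nn_integral lborel (\<lambda>w::'a. 0)"
    by (subst nn_integral_sphere_measure, simp, intro arg_cong2[where f="(*)"] nn_integral_cong refl)
       (auto split: split_indicator simp: norm_sgn)
  finally show "emeasure sphere_measure ?N = 0" by simp
qed

lemma nn_integral_inverse_power_tail:
  fixes a :: real and m :: nat
  assumes a: "a > 0" and m: "m > 0"
  shows "(\<integral>\<^sup>+s. ennreal (1 / s ^ Suc m) * indicator {a<..} s \<partial>lborel) = ennreal (1 / (real m * a ^ m))"
proof -
  have "(\<integral>\<^sup>+s. ennreal (1 / s ^ Suc m) * indicator {a<..} s \<partial>lborel)
      = (\<integral>\<^sup>+s. ennreal (1 / s ^ Suc m) * indicator {a..} s \<partial>lborel)"
    using AE_lborel_singleton[of a] by (intro nn_integral_cong_AE) (auto split: split_indicator)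
  also have "\<dots> = ennreal (0 - (- (1 / (real m * a ^ m))))"
  proof (rule nn_integral_FTC_atLeast)
    fix x assume x: "a \<le> x"
    have "((\<lambda>s. - (1 / (real m * s ^ m))) has_real_derivative
        (real m * (real m * x ^ (m - 1))) / (real m * x ^ m)\<^sup>2) (at x)"
      using a x m by (auto intro!: derivative_eq_intros simp: power2_eq_square)
    also have "(real m * (real m * x ^ (m - 1))) / (real m * x ^ m)\<^sup>2 = 1 / x ^ Suc m"
    proof -
      obtain n where n: "m = Suc n" using m by (cases m) auto
      define M where "M = real m"
      have "M \<noteq> 0" "x > 0" using a x m by (auto simp: M_def)
      then show ?thesis
        unfolding M_def[symmetric] unfolding n by (simp add: field_simps power2_eq_square)
    qed
    finally show "((\<lambda>s. - (1 / (real m * s ^ m))) has_real_derivative 1 / x ^ Suc m) (at x)" .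
    show "0 \<le> 1 / x ^ Suc m" using a x by simp
  next
    have "filterlim (\<lambda>s::real. real m * s ^ m) at_top at_top"
      using m by (intro filterlim_tendsto_pos_mult_at_top[OF tendsto_const]
          filterlim_pow_at_top filterlim_ident) auto
    then have "((\<lambda>s::real. inverse (real m * s ^ m)) \<longlongrightarrow> 0) at_top"
      by (rule tendsto_inverse_0_at_top)
    then have "((\<lambda>s::real. - inverse (real m * s ^ m)) \<longlongrightarrow> - 0) at_top"
      by (rule tendsto_minus)
    then show "((\<lambda>s::real. - (1 / (real m * s ^ m))) \<longlongrightarrow> 0) at_top"
      by (simp add: field_simps)
  qed simp
  finally show ?thesis by simp
qed

text \<open>
  The sphere measure is given by cones in the unit ball, so \<open>n\<close> is represented as \<open>sgn w\<close>
  with \<open>w\<close> in the punctured ball \<open>B\<close>. For fixed \<open>w\<close> put \<open>r = s |w|\<close>, and for fixed \<open>s\<close> put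
  \<open>w = z / s\<close>. The argument of \<open>h\<close> is then \<open>z\<close> alone, and the remaining weight
  \<open>m |z|\<^sup>m \<integral>\<^bsub>s > |z|\<^esub> s\<^sup>-\<^sup>m\<^sup>-\<^sup>1 ds\<close> equals 1.
\<close>

lemma nn_integral_polar:
  fixes h :: "'a::euclidean_space \<Rightarrow> ennreal"
  assumes [measurable]: "h \<in> borel_measurable borel"
  shows "(\<integral>\<^sup>+w. h w \<partial>lborel) =
    (\<integral>\<^sup>+r. (\<integral>\<^sup>+n. ennreal (indicator {0<..} r * r ^ (DIM('a) - 1)) * h (r *\<^sub>R n) \<partial>sphere_measure) \<partial>lborel)"
proof -
  define m where "m = DIM('a)"
  have m: "m > 0" by (simp add: m_def)
  define B where "B = ball 0 1 - {0 :: 'a}"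
  have [measurable]: "B \<in> sets borel" by (simp add: B_def)
  let ?P = "{0 :: real<..}"
  have "(\<integral>\<^sup>+r. (\<integral>\<^sup>+n. ennreal (indicator ?P r * r ^ (m - 1)) * h (r *\<^sub>R n) \<partial>sphere_measure) \<partial>lborel)
      = (\<integral>\<^sup>+r. of_nat m * (\<integral>\<^sup>+w. ennreal (indicator ?P r * r ^ (m - 1)) * h (r *\<^sub>R sgn w) * indicator B w \<partial>lborel) \<partial>lborel)"
    by (simp add: nn_integral_sphere_measure m_def B_def)
  also have "\<dots> = of_nat m * (\<integral>\<^sup>+r. \<integral>\<^sup>+w. ennreal (indicator ?P r * r ^ (m - 1)) * h (r *\<^sub>R sgn w) * indicator B w \<partial>lborel \<partial>lborel)"
    by (subst nn_integral_cmult) simp_all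
  \<comment> \<open>The scaling of \<open>r\<close> depends on \<open>w\<close>, hence the \<open>r\<close>-integral has to be the inner one.\<close>
  also have "(\<integral>\<^sup>+r. \<integral>\<^sup>+w. ennreal (indicator ?P r * r ^ (m - 1)) * h (r *\<^sub>R sgn w) * indicator B w \<partial>lborel \<partial>lborel)
      = (\<integral>\<^sup>+w. \<integral>\<^sup>+r. ennreal (indicator ?P r * r ^ (m - 1)) * h (r *\<^sub>R sgn w) * indicator B w \<partial>lborel \<partial>lborel)"
    by (rule lborel_pair.Fubini') simp
  also have "\<dots> = (\<integral>\<^sup>+w. \<integral>\<^sup>+s. ennreal (indicator ?P s * s ^ (m - 1) * norm w ^ m) * h (s *\<^sub>R w) * indicator B w \<partial>lborel \<partial>lborel)"
  proof (rule nn_integral_cong)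
    fix w :: 'a
    show "(\<integral>\<^sup>+r. ennreal (indicator ?P r * r ^ (m - 1)) * h (r *\<^sub>R sgn w) * indicator B w \<partial>lborel)
        = (\<integral>\<^sup>+s. ennreal (indicator ?P s * s ^ (m - 1) * norm w ^ m) * h (s *\<^sub>R w) * indicator B w \<partial>lborel)"
    proof (cases "w = 0")
      case False
      then have nw: "norm w > 0" by simp
      have "(\<integral>\<^sup>+r. ennreal (indicator ?P r * r ^ (m - 1)) * h (r *\<^sub>R sgn w) * indicator B w \<partial>lborel)
          = ennreal (norm w) * (\<integral>\<^sup>+s. ennreal (indicator ?P (norm w * s) * (norm w * s) ^ (m - 1)) * h ((norm w * s) *\<^sub>R sgn w) * indicator B w \<partial>lborel)"
        using nw by (subst nn_integral_lborel_affine[where c="norm w" and t=0]) simp_all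
      also have "\<dots> = (\<integral>\<^sup>+s. ennreal (norm w) * (ennreal (indicator ?P (norm w * s) * (norm w * s) ^ (m - 1)) * h ((norm w * s) *\<^sub>R sgn w) * indicator B w) \<partial>lborel)"
        by (subst nn_integral_cmult) simp_all
      also have "\<dots> = (\<integral>\<^sup>+s. ennreal (indicator ?P s * s ^ (m - 1) * norm w ^ m) * h (s *\<^sub>R w) * indicator B w \<partial>lborel)"
      proof (rule nn_integral_cong)
        fix s :: real
        have 1: "(norm w * s) *\<^sub>R sgn w = s *\<^sub>R w" using nw by (simp add: sgn_div_norm)
        have 2: "indicator ?P (norm w * s) = (indicator ?P s :: real)"
          using nw by (simp add: indicator_def zero_less_mult_iff)
        have "ennreal (norm w) * ennreal (indicator ?P s * (norm w * s) ^ (m - 1))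
          = ennreal (norm w * (indicator ?P s * (norm w * s) ^ (m - 1)))"
          using nw by (intro ennreal_mult[symmetric]) (auto split: split_indicator)
        also have "norm w * (indicator ?P s * (norm w * s) ^ (m - 1)) = indicator ?P s * s ^ (m - 1) * norm w ^ m"
          using m by (cases m) (simp_all add: power_mult_distrib)
        finally have 3: "ennreal (norm w) * ennreal (indicator ?P s * (norm w * s) ^ (m - 1))
            = ennreal (indicator ?P s * s ^ (m - 1) * norm w ^ m)" .
        show "ennreal (norm w) * (ennreal (indicator ?P (norm w * s) * (norm w * s) ^ (m - 1)) * h ((norm w * s) *\<^sub>R sgn w) * indicator B w)
          = ennreal (indicator ?P s * s ^ (m - 1) * norm w ^ m) * h (s *\<^sub>R w) * indicator B w"
          unfolding 1 2 3[symmetric] by (simp add: mult.assoc)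
      qed
      finally show ?thesis .
    next
      case True
      then have "indicator B w = (0 :: ennreal)" by (simp add: B_def)
      then show ?thesis by simp
    qed
  qed
  also have "\<dots> = (\<integral>\<^sup>+s. \<integral>\<^sup>+w. ennreal (indicator ?P s * s ^ (m - 1) * norm w ^ m) * h (s *\<^sub>R w) * indicator B w \<partial>lborel \<partial>lborel)"
    by (rule lborel_pair.Fubini') simp
  \<comment> \<open>The condition \<open>z / s \<in> B\<close> reads \<open>0 < |z| < s\<close>.\<close>
  also have "\<dots> = (\<integral>\<^sup>+s. \<integral>\<^sup>+z. ennreal (norm z ^ m) * h z * (ennreal (1 / s ^ Suc m) * (indicator {norm z<..} s * indicator (- {0}) z)) \<partial>lborel \<partial>lborel)"
  proof (rule nn_integral_cong)
    fix s :: real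
    show "(\<integral>\<^sup>+w. ennreal (indicator ?P s * s ^ (m - 1) * norm w ^ m) * h (s *\<^sub>R w) * indicator B w \<partial>lborel)
      = (\<integral>\<^sup>+z. ennreal (norm z ^ m) * h z * (ennreal (1 / s ^ Suc m) * (indicator {norm z<..} s * indicator (- {0}) z)) \<partial>lborel)"
    proof (cases "s > 0")
      case s: True
      have "(\<integral>\<^sup>+z. ennreal (norm z ^ m) * h z * (ennreal (1 / s ^ Suc m) * (indicator {norm z<..} s * indicator (- {0}) z)) \<partial>lborel)
         = ennreal (s ^ m) * (\<integral>\<^sup>+w. ennreal (norm (s *\<^sub>R w) ^ m) * h (s *\<^sub>R w) * (ennreal (1 / s ^ Suc m) * (indicator {norm (s *\<^sub>R w)<..} s * indicator (- {0}) (s *\<^sub>R w))) \<partial>lborel)"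
        using s by (subst nn_integral_lborel_affine[where c=s and t=0])
          (simp_all add: m_def indicator_def[of "{_<..}"])
      also have "\<dots> = (\<integral>\<^sup>+w. ennreal (s ^ m) * (ennreal (norm (s *\<^sub>R w) ^ m) * h (s *\<^sub>R w) * (ennreal (1 / s ^ Suc m) * (indicator {norm (s *\<^sub>R w)<..} s * indicator (- {0}) (s *\<^sub>R w)))) \<partial>lborel)"
        by (subst nn_integral_cmult) (simp_all add: indicator_def[of "{_<..}"])
      also have "\<dots> = (\<integral>\<^sup>+w. ennreal (indicator ?P s * s ^ (m - 1) * norm w ^ m) * h (s *\<^sub>R w) * indicator B w \<partial>lborel)"
      proof (rule nn_integral_cong)
        fix w :: 'a
        have 1: "indicator {norm (s *\<^sub>R w)<..} s * indicator (- {0}) (s *\<^sub>R w) = (indicator B w :: ennreal)"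
          using s by (auto simp: indicator_def B_def)
        have "ennreal (s ^ m) * ennreal (norm (s *\<^sub>R w) ^ m) * ennreal (1 / s ^ Suc m)
            = ennreal (s ^ m * norm (s *\<^sub>R w) ^ m * (1 / s ^ Suc m))"
        proof -
          have "0 \<le> s ^ m" "0 \<le> norm (s *\<^sub>R w) ^ m" "0 \<le> 1 / s ^ Suc m" using s by simp_all
          then show ?thesis by (metis ennreal_mult mult_nonneg_nonneg)
        qed
        also have "s ^ m * norm (s *\<^sub>R w) ^ m * (1 / s ^ Suc m) = indicator ?P s * s ^ (m - 1) * norm w ^ m"
          using s m by (cases m) (simp_all add: power_mult_distrib)
        finally have 2: "ennreal (s ^ m) * ennreal (norm (s *\<^sub>R w) ^ m) * ennreal (1 / s ^ Suc m)
            = ennreal (indicator ?P s * s ^ (m - 1) * norm w ^ m)" .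
        show "ennreal (s ^ m) * (ennreal (norm (s *\<^sub>R w) ^ m) * h (s *\<^sub>R w) * (ennreal (1 / s ^ Suc m) * (indicator {norm (s *\<^sub>R w)<..} s * indicator (- {0}) (s *\<^sub>R w))))
          = ennreal (indicator ?P s * s ^ (m - 1) * norm w ^ m) * h (s *\<^sub>R w) * indicator B w"
          unfolding 1 2[symmetric] by (simp add: mult_ac)
      qed
      finally show ?thesis ..
    next
      case False
      then have "\<And>z::'a. \<not> norm z < s"
        by (meson norm_ge_zero order_le_less_trans)
      with False show ?thesis by simp
    qed
  qed
  also have "\<dots> = (\<integral>\<^sup>+z. \<integral>\<^sup>+s. ennreal (norm z ^ m) * h z * (ennreal (1 / s ^ Suc m) * (indicator {norm z<..} s * indicator (- {0}) z)) \<partial>lborel \<partial>lborel)"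
    by (rule lborel_pair.Fubini') (simp add: indicator_def[of "{_<..}"])
  also have "\<dots> = (\<integral>\<^sup>+z. ennreal (1 / real m) * h z \<partial>lborel)"
  proof (rule nn_integral_cong_AE)
    show "AE z in lborel. (\<integral>\<^sup>+s. ennreal (norm z ^ m) * h z * (ennreal (1 / s ^ Suc m) * (indicator {norm z<..} s * indicator (- {0}) z)) \<partial>lborel) = ennreal (1 / real m) * h z"
      using AE_lborel_singleton[of "0::'a"]
    proof eventually_elim
      case (elim z)
      have "(\<integral>\<^sup>+s. ennreal (norm z ^ m) * h z * (ennreal (1 / s ^ Suc m) * (indicator {norm z<..} s * indicator (- {0}) z)) \<partial>lborel)
        = ennreal (norm z ^ m) * h z * (\<integral>\<^sup>+s. ennreal (1 / s ^ Suc m) * indicator {norm z<..} s \<partial>lborel)"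
        using elim by (subst nn_integral_cmult[symmetric]) simp_all
      also have "\<dots> = ennreal (norm z ^ m) * h z * ennreal (1 / (real m * norm z ^ m))"
        using elim m by (subst nn_integral_inverse_power_tail) simp_all
      also have "\<dots> = ennreal (norm z ^ m) * ennreal (1 / (real m * norm z ^ m)) * h z"
        by (simp only: mult_ac)
      also have "ennreal (norm z ^ m) * ennreal (1 / (real m * norm z ^ m)) = ennreal (1 / real m)"
        using elim by (subst ennreal_mult[symmetric]) simp_all
      finally show ?case .
    qed
  qed
  also have "of_nat m * (\<integral>\<^sup>+z. ennreal (1 / real m) * h z \<partial>lborel) = (\<integral>\<^sup>+z. h z \<partial>lborel)"
  proof -
    have "of_nat m * ennreal (1 / real m) = 1"
      using m by (simp add: ennreal_of_nat_eq_real_of_nat flip: ennreal_mult)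
    then show ?thesis
      by (simp add: nn_integral_cmult flip: mult.assoc)
  qed
  finally show ?thesis unfolding m_def ..
qed

text \<open>
  As an identity of measures, the polar formula transfers to Bochner integrals.
\<close>

lemma lborel_eq_distr_polar:
  "(lborel :: 'a::euclidean_space measure) =
    distr (density (lborel \<Otimes>\<^sub>M sphere_measure) (\<lambda>(r, n). ennreal (indicator {0<..} r * r ^ (DIM('a) - 1))))
      borel (\<lambda>(r, n). r *\<^sub>R n)"
  (is "_ = distr (density ?L ?d) borel ?T")
proof (rule measure_eqI)
  show "sets lborel = sets (distr (density ?L ?d) borel ?T)" by simp
  fix A :: "'a set" assume "A \<in> sets lborel"
  then have [measurable]: "A \<in> sets borel" by simp
  have [measurable]: "?T \<in> measurable ?L borel"
    "?d \<in> borel_measurable ?L" by measurable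
  have "emeasure (distr (density ?L ?d) borel ?T) A
      = (\<integral>\<^sup>+w. indicator A w \<partial>distr (density ?L ?d) borel ?T)" by simp
  also have "\<dots> = (\<integral>\<^sup>+z. ?d z * indicator A (?T z) \<partial>?L)"
    by (subst nn_integral_distr, simp, simp, subst nn_integral_density) simp_all
  also have "\<dots> = (\<integral>\<^sup>+r. (\<integral>\<^sup>+n. ?d (r, n) * indicator A (?T (r, n)) \<partial>sphere_measure) \<partial>lborel)"
    by (rule sphere_measure.nn_integral_fst[symmetric]) measurable
  also have "\<dots> = (\<integral>\<^sup>+w. indicator A w \<partial>lborel)"
    by (subst nn_integral_polar) simp_all
  finally show "emeasure lborel A = emeasure (distr (density ?L ?d) borel ?T) A" by simp
qed

theorem polar_coordinates:
  fixes h :: "'a::euclidean_space \<Rightarrow> 'b::{banach, second_countable_topology}"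
  assumes int: "integrable lborel h"
  shows "set_integrable lborel {0<..} (\<lambda>r. r ^ (DIM('a) - 1) *\<^sub>R (LINT n|sphere_measure. h (r *\<^sub>R n)))"
    and "(LINT w|lborel. h w) =
      (LINT r:{0<..}|lborel. r ^ (DIM('a) - 1) *\<^sub>R (LINT n|sphere_measure. h (r *\<^sub>R n)))"
proof -
  let ?L = "lborel \<Otimes>\<^sub>M (sphere_measure :: 'a measure)"
  let ?d = "\<lambda>(r::real, n::'a). indicator {0<..} r * r ^ (DIM('a) - 1) :: real"
  let ?T = "\<lambda>(r::real, n::'a). r *\<^sub>R n"
  interpret P: pair_sigma_finite lborel "sphere_measure :: 'a measure" ..
  have [measurable]: "h \<in> borel_measurable borel" using int by auto
  have [measurable]: "?T \<in> measurable ?L borel" "?d \<in> borel_measurable ?L" by measurable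
  have M: "lborel = distr (density ?L (\<lambda>z. ennreal (?d z))) borel ?T"
    by (subst lborel_eq_distr_polar) (simp add: case_prod_unfold)
  have nn: "AE z in ?L. 0 \<le> ?d z" by (auto split: split_indicator)
  have "integrable (distr (density ?L (\<lambda>z. ennreal (?d z))) borel ?T) h"
    using int arg_cong[OF M, of "\<lambda>M. integrable M h"] by blast
  then have I: "integrable ?L (\<lambda>z. ?d z *\<^sub>R h (?T z))"
    by (subst (asm) integrable_distr_eq, simp, simp, subst (asm) integrable_density) (use nn in simp_all)
  have eq: "(LINT n|sphere_measure. ?d (r, n) *\<^sub>R h (?T (r, n)))
      = indicator {0<..} r *\<^sub>R r ^ (DIM('a) - 1) *\<^sub>R (LINT n|sphere_measure. h (r *\<^sub>R n))" for r
    by (simp add: mult.commute)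
  have "integrable lborel (\<lambda>r. LINT n|sphere_measure. ?d (r, n) *\<^sub>R h (?T (r, n)))"
    by (rule P.integrable_fst'[OF I])
  then show "set_integrable lborel {0<..} (\<lambda>r. r ^ (DIM('a) - 1) *\<^sub>R (LINT n|sphere_measure. h (r *\<^sub>R n)))"
    unfolding eq set_integrable_def .
  have "(LINT w|lborel. h w) = (LINT w|distr (density ?L (\<lambda>z. ennreal (?d z))) borel ?T. h w)"
    by (rule arg_cong[OF M])
  also have "\<dots> = (LINT z|?L. ?d z *\<^sub>R h (?T z))"
    by (subst integral_distr, simp, simp, subst integral_density) (use nn in simp_all)
  also have "\<dots> = (LINT r|lborel. LINT n|sphere_measure. ?d (r, n) *\<^sub>R h (?T (r, n)))"
    by (rule P.integral_fst'[OF I, symmetric])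
  also have "\<dots> = (LINT r:{0<..}|lborel. r ^ (DIM('a) - 1) *\<^sub>R (LINT n|sphere_measure. h (r *\<^sub>R n)))"
    unfolding eq set_lebesgue_integral_def ..
  finally show "(LINT w|lborel. h w) =
      (LINT r:{0<..}|lborel. r ^ (DIM('a) - 1) *\<^sub>R (LINT n|sphere_measure. h (r *\<^sub>R n)))" .
qed

section \<open>Invariance under reflections\<close>

text \<open>
  A translation-invariant, locally finite Borel measure is determined up to a factor, and the
  unit ball, which \<open>T\<close> maps to itself, fixes that factor. In concrete terms, the double integral
  of \<open>h (T x) g y\<close>, with \<open>h\<close> the indicator of the unit ball, is rewritten by translations that
  move the integration from \<open>g\<close> to \<open>g \<circ> T\<close>.
\<close>

lemma nn_integral_lborel_norm_preserving_involution:
  fixes T :: "'a::euclidean_space \<Rightarrow> 'a" and g :: "'a \<Rightarrow> ennreal"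
  assumes lin: "linear T" and nrm: "\<And>w. norm (T w) = norm w" and inv: "\<And>w. T (T w) = w"
    and [measurable]: "g \<in> borel_measurable borel"
  shows "(\<integral>\<^sup>+w. g (T w) \<partial>lborel) = (\<integral>\<^sup>+w. g w \<partial>lborel)"
proof -
  have [measurable]: "T \<in> borel_measurable borel"
    using lin by (intro borel_measurable_continuous_onI linear_continuous_on) (simp add: linear_linear)
  have [measurable]: "ball 0 1 \<in> sets (borel :: 'a measure)" by simp
  let ?h = "indicator (ball 0 1) :: 'a \<Rightarrow> ennreal"
  have shift: "(\<integral>\<^sup>+x. q x \<partial>lborel) = (\<integral>\<^sup>+x. q (t + x) \<partial>lborel)"
    if [measurable]: "q \<in> borel_measurable borel" for q and t :: 'a
    using nn_integral_lborel_affine[of q 1 t] that by simp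
  have flip: "(\<integral>\<^sup>+x. q x \<partial>lborel) = (\<integral>\<^sup>+x. q (t - x) \<partial>lborel)"
    if [measurable]: "q \<in> borel_measurable borel" for q and t :: 'a
    using nn_integral_lborel_affine[of q "-1" t] that by simp
  have "(\<integral>\<^sup>+w. g w \<partial>lborel) * (\<integral>\<^sup>+x. ?h x \<partial>lborel) = (\<integral>\<^sup>+x. \<integral>\<^sup>+y. ?h (T x) * g y \<partial>lborel \<partial>lborel)"
  proof -
    have "?h (T x) = ?h x" for x using nrm by (simp add: indicator_def)
    then have "(\<integral>\<^sup>+x. \<integral>\<^sup>+y. ?h (T x) * g y \<partial>lborel \<partial>lborel)
        = (\<integral>\<^sup>+x. ?h x * (\<integral>\<^sup>+y. g y \<partial>lborel) \<partial>lborel)"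
      by (simp add: nn_integral_cmult)
    also have "\<dots> = (\<integral>\<^sup>+x. ?h x \<partial>lborel) * (\<integral>\<^sup>+y. g y \<partial>lborel)"
      by (rule nn_integral_multc) measurable
    finally show ?thesis by (simp add: mult.commute)
  qed
  also have "\<dots> = (\<integral>\<^sup>+x. \<integral>\<^sup>+y. ?h (T x) * g (T x + y) \<partial>lborel \<partial>lborel)"
    by (rule nn_integral_cong, rule shift) simp
  also have "\<dots> = (\<integral>\<^sup>+y. \<integral>\<^sup>+x. ?h (T x) * g (T x + y) \<partial>lborel \<partial>lborel)"
    by (rule lborel_pair.Fubini') measurable
  also have "\<dots> = (\<integral>\<^sup>+y. \<integral>\<^sup>+x. ?h (T x - y) * g (T x) \<partial>lborel \<partial>lborel)"
  proof (rule nn_integral_cong)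
    fix y
    have 1: "T (x - T y) = T x - y" for x
      using lin by (simp add: linear_add linear_neg linear_diff inv)
    show "(\<integral>\<^sup>+x. ?h (T x) * g (T x + y) \<partial>lborel) = (\<integral>\<^sup>+x. ?h (T x - y) * g (T x) \<partial>lborel)"
      by (subst shift[where t="- T y"]) (simp_all add: 1)
  qed
  also have "\<dots> = (\<integral>\<^sup>+x. \<integral>\<^sup>+y. ?h (T x - y) * g (T x) \<partial>lborel \<partial>lborel)"
    by (rule lborel_pair.Fubini') measurable
  also have "\<dots> = (\<integral>\<^sup>+x. (\<integral>\<^sup>+y. ?h y \<partial>lborel) * g (T x) \<partial>lborel)"
  proof (rule nn_integral_cong)
    fix x
    have "(\<integral>\<^sup>+y. ?h (T x - y) * g (T x) \<partial>lborel) = (\<integral>\<^sup>+y. ?h (T x - y) \<partial>lborel) * g (T x)"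
      by (rule nn_integral_multc) simp
    also have "(\<integral>\<^sup>+y. ?h (T x - y) \<partial>lborel) = (\<integral>\<^sup>+y. ?h y \<partial>lborel)"
      by (rule flip[symmetric]) simp
    finally show "(\<integral>\<^sup>+y. ?h (T x - y) * g (T x) \<partial>lborel) = (\<integral>\<^sup>+y. ?h y \<partial>lborel) * g (T x)" .
  qed
  also have "\<dots> = (\<integral>\<^sup>+w. g (T w) \<partial>lborel) * (\<integral>\<^sup>+x. ?h x \<partial>lborel)"
    by (subst nn_integral_cmult) (measurable, simp only: mult.commute)
  finally have eq: "(\<integral>\<^sup>+w. g w \<partial>lborel) * emeasure lborel (ball 0 1 :: 'a set)
      = (\<integral>\<^sup>+w. g (T w) \<partial>lborel) * emeasure lborel (ball 0 1 :: 'a set)" by simp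
  have fin: "emeasure lborel (ball 0 1 :: 'a set) < top"
    using emeasure_bounded_finite[of "ball 0 1 :: 'a set"] by simp
  have pos: "emeasure lborel (ball 0 1 :: 'a set) \<noteq> 0"
    using content_ball_pos[of 1 "0::'a"] by (auto simp: measure_def)
  show ?thesis
    using eq fin pos by (auto simp add: mult.commute[of _ "emeasure lborel (ball 0 1 :: 'a set)"] ennreal_mult_cancel_left)
qed

lemma lborel_distr_norm_preserving_involution:
  fixes T :: "'a::euclidean_space \<Rightarrow> 'a"
  assumes lin: "linear T" and nrm: "\<And>w. norm (T w) = norm w" and inv: "\<And>w. T (T w) = w"
  shows "distr lborel borel T = lborel"
proof (rule measure_eqI)
  have [measurable]: "T \<in> borel_measurable borel"
    using lin by (intro borel_measurable_continuous_onI linear_continuous_on) (simp add: linear_linear)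
  fix A assume "A \<in> sets (distr lborel borel T)"
  then have [measurable]: "A \<in> sets borel" by simp
  have "emeasure (distr lborel borel T) A = (\<integral>\<^sup>+w. indicator A w \<partial>distr lborel borel T)" by simp
  also have "\<dots> = (\<integral>\<^sup>+w. indicator A (T w) \<partial>lborel)" by (subst nn_integral_distr) simp_all
  also have "\<dots> = (\<integral>\<^sup>+w. indicator A w \<partial>lborel)"
    by (rule nn_integral_lborel_norm_preserving_involution[OF assms]) simp
  finally show "emeasure (distr lborel borel T) A = emeasure lborel A" by simp
qed simp

lemma lborel_integral_norm_preserving_involution:
  fixes T :: "'a::euclidean_space \<Rightarrow> 'a" and g :: "'a \<Rightarrow> 'b::{banach, second_countable_topology}"
  assumes lin: "linear T" and nrm: "\<And>w. norm (T w) = norm w" and inv: "\<And>w. T (T w) = w"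
    and g [measurable]: "g \<in> borel_measurable borel"
  shows "(LINT w|lborel. g (T w)) = (LINT w|lborel. g w)"
proof -
  have T: "T \<in> borel_measurable borel"
    using lin by (intro borel_measurable_continuous_onI linear_continuous_on) (simp add: linear_linear)
  have "(LINT w|lborel. g w) = (LINT w|distr lborel borel T. g w)"
    by (simp add: lborel_distr_norm_preserving_involution[OF lin nrm inv])
  also have "\<dots> = (LINT w|lborel. g (T w))"
    by (rule integral_distr) (use T in simp_all)
  finally show ?thesis ..
qed

text \<open>
  The reflection in the hyperplane orthogonal to \<open>a - b\<close>; for \<open>a = b\<close> the quotient
  by \<open>(a - b) \<bullet> (a - b) = 0\<close> is 0, and the same formula gives the identity.
\<close>

lemma reflection_between_equal_norms:
  fixes a b :: "'a::euclidean_space"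
  assumes ab: "norm a = norm b"
  obtains T where "linear T" "\<And>w. norm (T w) = norm w" "\<And>w. T (T w) = w"
    "\<And>v w. T v \<bullet> T w = v \<bullet> w" "T a = b"
proof -
  define c where "c = a - b"
  define T where "T w = w - (2 * (w \<bullet> c) / (c \<bullet> c)) *\<^sub>R c" for w
  have iso: "T v \<bullet> T w = v \<bullet> w" for v w
    by (cases "c = 0") (simp_all add: T_def inner_simps inner_commute field_simps)
  show ?thesis
  proof (rule that[of T])
    show "linear T"
      by (rule linearI) (simp_all add: T_def inner_simps algebra_simps add_divide_distrib)
    show "norm (T w) = norm w" for w by (simp add: norm_eq_sqrt_inner iso)
    show "T (T w) = w" for w
      by (cases "c = 0") (simp_all add: T_def inner_simps field_simps)
    show "T v \<bullet> T w = v \<bullet> w" for v w by (rule iso)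
    show "T a = b"
    proof (cases "c = 0")
      case False
      have "a \<bullet> a = b \<bullet> b" using ab by (simp add: norm_eq_sqrt_inner)
      then have "2 * (a \<bullet> c) = c \<bullet> c"
        by (simp add: c_def inner_simps inner_commute)
      with False show ?thesis by (simp add: T_def) (simp add: c_def)
    qed (simp add: T_def c_def)
  qed
qed

section \<open>The Fourier transform and its inversion\<close>

lemma lborel_integral_prod:
  fixes f :: "'a::euclidean_space \<Rightarrow> real \<Rightarrow> 'b::{real_normed_field, banach, second_countable_topology}"
  assumes int: "\<And>b. b \<in> Basis \<Longrightarrow> integrable lborel (f b)"
  shows "integrable lborel (\<lambda>z. \<Prod>b\<in>Basis. f b (z \<bullet> b))"
    and "(LINT z|lborel. (\<Prod>b\<in>Basis. f b (z \<bullet> b))) = (\<Prod>b\<in>Basis. (LINT x|lborel. f b x))"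
proof -
  interpret P: product_sigma_finite "\<lambda>_::'a. lborel :: real measure" ..
  have [measurable]: "f b \<in> borel_measurable borel" if "b \<in> Basis" for b
    using int[OF that] by simp
  have eq: "(\<Prod>b\<in>Basis. f b ((\<Sum>c\<in>Basis. x c *\<^sub>R c) \<bullet> b)) = (\<Prod>b\<in>Basis. f b (x b))" for x
    by (intro prod.cong refl arg_cong2[where f=f]) simp
  have [measurable]: "(\<lambda>x. \<Sum>b\<in>Basis. x b *\<^sub>R b) \<in> measurable (\<Pi>\<^sub>M b\<in>Basis. lborel) (borel :: 'a measure)"
    by measurable
  show "integrable lborel (\<lambda>z. \<Prod>b\<in>Basis. f b (z \<bullet> b))"
    unfolding lborel_eq[where 'a='a]
    by (subst integrable_distr_eq) (use P.product_integrable_prod[of Basis f] int in \<open>simp_all add: eq\<close>)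
  show "(LINT z|lborel. (\<Prod>b\<in>Basis. f b (z \<bullet> b))) = (\<Prod>b\<in>Basis. (LINT x|lborel. f b x))"
    unfolding lborel_eq[where 'a='a]
    by (subst integral_distr) (use P.product_integral_prod[of Basis f] int in \<open>simp_all add: eq\<close>)
qed

lemma gaussian_fourier_real:
  fixes t :: real
  shows "integrable lborel (\<lambda>x. cis (x * t) * complex_of_real (exp (- (x\<^sup>2 / 2))))"
    and "(LINT x|lborel. cis (x * t) * complex_of_real (exp (- (x\<^sup>2 / 2))))
      = complex_of_real (sqrt (2 * pi) * exp (- (t\<^sup>2 / 2)))"
proof -
  have eq: "cis (x * t) * complex_of_real (exp (- (x\<^sup>2 / 2)))
      = complex_of_real (sqrt (2 * pi)) * (std_normal_density x *\<^sub>R iexp (t * x))" for x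
    by (simp add: std_normal_density_def cis_conv_exp scaleR_conv_of_real mult.commute)
  have I: "integrable lborel (\<lambda>x. std_normal_density x *\<^sub>R iexp (t * x))"
    by (rule Bochner_Integration.integrable_bound[OF integrable_normal_moment[of 1 0 0]])
       (auto simp: norm_mult)
  show "integrable lborel (\<lambda>x. cis (x * t) * complex_of_real (exp (- (x\<^sup>2 / 2))))"
    unfolding eq using I by (intro integrable_mult_right) simp
  have "(LINT x|lborel. std_normal_density x *\<^sub>R iexp (t * x)) = char std_normal_distribution t"
    unfolding char_def by (subst integral_density) auto
  also have "\<dots> = complex_of_real (exp (- (t\<^sup>2 / 2)))"
    by (simp add: char_std_normal_distribution)
  finally show "(LINT x|lborel. cis (x * t) * complex_of_real (exp (- (x\<^sup>2 / 2))))
      = complex_of_real (sqrt (2 * pi) * exp (- (t\<^sup>2 / 2)))"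
    unfolding eq integral_mult_right_zero by simp
qed

definition gaussian :: "'a::euclidean_space \<Rightarrow> real" where
  "gaussian z = exp (- ((norm z)\<^sup>2 / 2))"

lemma gaussian_measurable [measurable]: "gaussian \<in> borel_measurable borel"
  unfolding gaussian_def[abs_def] by measurable

lemma gaussian_fourier:
  fixes \<zeta> :: "'a::euclidean_space"
  shows "integrable lborel (\<lambda>z. cis (z \<bullet> \<zeta>) * complex_of_real (gaussian z))"
    and "(LINT z|lborel. cis (z \<bullet> \<zeta>) * complex_of_real (gaussian z))
      = complex_of_real (sqrt (2 * pi) ^ DIM('a) * gaussian \<zeta>)"
proof -
  let ?f = "\<lambda>b x. cis (x * (\<zeta> \<bullet> b)) * complex_of_real (exp (- (x\<^sup>2 / 2)))"
  have g: "gaussian z = (\<Prod>b\<in>Basis. exp (- ((z \<bullet> b)\<^sup>2 / 2)))" for z :: 'a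
  proof -
    have "(norm z)\<^sup>2 = (\<Sum>b\<in>Basis. (z \<bullet> b)\<^sup>2)"
      by (subst power2_norm_eq_inner, subst euclidean_inner) (simp add: power2_eq_square)
    then show ?thesis
      by (simp add: gaussian_def exp_sum[symmetric] sum_negf sum_divide_distrib)
  qed
  have c: "cis (z \<bullet> \<zeta>) = (\<Prod>b\<in>Basis. cis ((z \<bullet> b) * (\<zeta> \<bullet> b)))" for z :: 'a
    by (subst euclidean_inner) (simp add: cis_conv_exp sum_distrib_left exp_sum)
  have eq: "cis (z \<bullet> \<zeta>) * complex_of_real (gaussian z) = (\<Prod>b\<in>Basis. ?f b (z \<bullet> b))" for z
    by (simp add: c g prod.distrib)
  show "integrable lborel (\<lambda>z. cis (z \<bullet> \<zeta>) * complex_of_real (gaussian z))"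
    unfolding eq by (rule lborel_integral_prod(1)) (rule gaussian_fourier_real)
  show "(LINT z|lborel. cis (z \<bullet> \<zeta>) * complex_of_real (gaussian z))
      = complex_of_real (sqrt (2 * pi) ^ DIM('a) * gaussian \<zeta>)"
    unfolding eq
    by (subst lborel_integral_prod(2)) (simp_all add: gaussian_fourier_real g prod.distrib)
qed

text \<open>
  The normalisation without a prefactor agrees with \<^const>\<open>fourier_fst\<close>; inversion then carries
  the factor \<open>(2 \<pi>)\<^sup>-\<^sup>n\<close>.
\<close>

definition fourier :: "('a::euclidean_space \<Rightarrow> complex) \<Rightarrow> 'a \<Rightarrow> complex" where
  "fourier h \<zeta> = (LINT z|lborel. cis (- (\<zeta> \<bullet> z)) * h z)"

lemma borel_measurable_cis [measurable]: "cis \<in> borel_measurable borel"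
  by (intro borel_measurable_continuous_onI continuous_intros)

lemma integrable_cis_mult:
  fixes h :: "'a::euclidean_space \<Rightarrow> complex"
  assumes h: "integrable lborel h" and [measurable]: "q \<in> borel_measurable borel"
  shows "integrable lborel (\<lambda>z. cis (q z) * h z)"
  by (rule Bochner_Integration.integrable_bound[OF h]) (use h in \<open>auto simp: norm_mult\<close>)

lemma fourier_measurable [measurable]:
  assumes [measurable]: "h \<in> borel_measurable borel"
  shows "fourier h \<in> borel_measurable borel"
  unfolding fourier_def[abs_def] by measurable

lemma norm_fourier_le:
  "norm (fourier h \<zeta>) \<le> (LINT z|lborel. norm (h z))"
  unfolding fourier_def
  by (rule order_trans[OF integral_norm_bound]) (simp add: norm_mult)

text \<open>
  Inserting the factor \<open>gaussian (\<epsilon> \<zeta>)\<close> makes the inversion integral absolutely convergent as a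
  double integral. Its inner integral is the transform of a Gaussian, so that the regularised
  integral is an average of \<open>h\<close> over a Gaussian of width \<open>\<epsilon>\<close> around \<open>z\<close>. Letting \<open>\<epsilon>\<close> tend to 0
  on both sides, by dominated convergence, gives the claim.
\<close>

theorem fourier_inversion:
  fixes h :: "'a::euclidean_space \<Rightarrow> complex"
  assumes h: "integrable lborel h" and cont: "continuous_on UNIV h" and bdd: "\<And>z. norm (h z) \<le> M"
    and hh: "integrable lborel (fourier h)"
  shows "(LINT \<zeta>|lborel. cis (\<zeta> \<bullet> z) * fourier h \<zeta>) = complex_of_real ((2 * pi) ^ DIM('a)) * h z"
proof -
  define N where "N = DIM('a)"
  have [measurable]: "h \<in> borel_measurable borel" using h by simp
  define \<epsilon> where "\<epsilon> n = inverse (real (Suc n))" for n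
  have \<epsilon>: "\<epsilon> n > 0" for n by (simp add: \<epsilon>_def)
  have \<epsilon>0: "\<epsilon> \<longlonglongrightarrow> 0" unfolding \<epsilon>_def[abs_def] by (rule LIMSEQ_inverse_real_of_nat)
  have gint: "integrable lborel (\<lambda>z::'a. complex_of_real (gaussian z))"
    and gval: "(LINT z::'a|lborel. complex_of_real (gaussian z)) = complex_of_real (sqrt (2 * pi) ^ N)"
    using gaussian_fourier[of "0::'a"] by (simp_all add: N_def gaussian_def)
  have g1: "gaussian v \<le> 1" "gaussian v \<ge> 0" for v :: 'a by (simp_all add: gaussian_def)
  define I where "I n = (LINT \<zeta>|lborel. cis (\<zeta> \<bullet> z) * (complex_of_real (gaussian (\<epsilon> n *\<^sub>R \<zeta>)) * fourier h \<zeta>))" for n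
  have lim1: "I \<longlonglongrightarrow> (LINT \<zeta>|lborel. cis (\<zeta> \<bullet> z) * fourier h \<zeta>)"
    unfolding I_def
  proof (rule integral_dominated_convergence[where w="\<lambda>\<zeta>. norm (fourier h \<zeta>)"])
    show "AE \<zeta> in lborel. (\<lambda>n. cis (\<zeta> \<bullet> z) * (complex_of_real (gaussian (\<epsilon> n *\<^sub>R \<zeta>)) * fourier h \<zeta>))
        \<longlonglongrightarrow> cis (\<zeta> \<bullet> z) * fourier h \<zeta>"
    proof (rule AE_I2)
      fix \<zeta> :: 'a
      have "(\<lambda>n. exp (- ((norm (\<epsilon> n *\<^sub>R \<zeta>))\<^sup>2 / 2))) \<longlonglongrightarrow> exp (- ((norm (0 *\<^sub>R \<zeta>))\<^sup>2 / 2))"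
        by (intro tendsto_intros \<epsilon>0) simp
      then have "(\<lambda>n. gaussian (\<epsilon> n *\<^sub>R \<zeta>)) \<longlonglongrightarrow> 1" by (simp add: gaussian_def)
      then have "(\<lambda>n. cis (\<zeta> \<bullet> z) * (complex_of_real (gaussian (\<epsilon> n *\<^sub>R \<zeta>)) * fourier h \<zeta>))
          \<longlonglongrightarrow> cis (\<zeta> \<bullet> z) * (complex_of_real 1 * fourier h \<zeta>)"
        by (intro tendsto_intros)
      then show "(\<lambda>n. cis (\<zeta> \<bullet> z) * (complex_of_real (gaussian (\<epsilon> n *\<^sub>R \<zeta>)) * fourier h \<zeta>))
        \<longlonglongrightarrow> cis (\<zeta> \<bullet> z) * fourier h \<zeta>" by simp
    qed
    show "AE \<zeta> in lborel. norm (cis (\<zeta> \<bullet> z) * (complex_of_real (gaussian (\<epsilon> n *\<^sub>R \<zeta>)) * fourier h \<zeta>))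
        \<le> norm (fourier h \<zeta>)" for n
      using g1 by (auto simp: norm_mult intro!: mult_left_le_one_le)
  qed (use hh in auto)
  have I_eq: "I n = complex_of_real (sqrt (2 * pi) ^ N) * (LINT v|lborel. h (z + \<epsilon> n *\<^sub>R v) * complex_of_real (gaussian v))" for n
  proof -
    let ?e = "\<epsilon> n"
    have "I n = (LINT \<zeta>|lborel. LINT w|lborel. cis (\<zeta> \<bullet> (z - w)) * complex_of_real (gaussian (?e *\<^sub>R \<zeta>)) * h w)"
      unfolding I_def fourier_def integral_mult_right_zero[symmetric]
    proof (intro Bochner_Integration.integral_cong refl)
      fix \<zeta> w :: 'a
      have "cis (\<zeta> \<bullet> (z - w)) = cis (\<zeta> \<bullet> z) * cis (- (\<zeta> \<bullet> w))"
        by (simp add: cis_mult inner_diff_right)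
      then show "cis (\<zeta> \<bullet> z) * (complex_of_real (gaussian (?e *\<^sub>R \<zeta>)) * (cis (- (\<zeta> \<bullet> w)) * h w))
          = cis (\<zeta> \<bullet> (z - w)) * complex_of_real (gaussian (?e *\<^sub>R \<zeta>)) * h w"
        by (simp only: mult_ac)
    qed
    also have "\<dots> = (LINT w|lborel. LINT \<zeta>|lborel. cis (\<zeta> \<bullet> (z - w)) * complex_of_real (gaussian (?e *\<^sub>R \<zeta>)) * h w)"
    proof (rule lborel_pair.Fubini_integral)
      have ge: "integrable lborel (\<lambda>\<zeta>::'a. complex_of_real (gaussian (?e *\<^sub>R \<zeta>)))"
        using lborel_integral_affine(1)[of "\<lambda>\<zeta>::'a. complex_of_real (gaussian \<zeta>)" ?e 0] gint \<epsilon>[of n] by simp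
      have "integrable (lborel \<Otimes>\<^sub>M lborel) (\<lambda>(w, \<zeta>::'a). h w * complex_of_real (gaussian (?e *\<^sub>R \<zeta>)))"
        by (rule lborel_pair.Fubini_integrable) (use h ge in \<open>auto simp: norm_mult intro!: AE_I2 integrable_mult_right\<close>)
      then show "integrable (lborel \<Otimes>\<^sub>M lborel) (\<lambda>(w, \<zeta>). cis (\<zeta> \<bullet> (z - w)) * complex_of_real (gaussian (?e *\<^sub>R \<zeta>)) * h w)"
        by (rule Bochner_Integration.integrable_bound) (auto simp: norm_mult)
    qed
    also have "\<dots> = (LINT w|lborel. complex_of_real (inverse ?e ^ N * sqrt (2 * pi) ^ N) * (complex_of_real (gaussian (inverse ?e *\<^sub>R (z - w))) * h w))"
    proof (intro Bochner_Integration.integral_cong refl)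
      fix w
      have "(LINT \<zeta>|lborel. cis (\<zeta> \<bullet> (z - w)) * complex_of_real (gaussian (?e *\<^sub>R \<zeta>)) * h w)
        = (LINT \<zeta>|lborel. cis (\<zeta> \<bullet> (z - w)) * complex_of_real (gaussian (?e *\<^sub>R \<zeta>))) * h w"
        by simp
      also have "(LINT \<zeta>|lborel. cis (\<zeta> \<bullet> (z - w)) * complex_of_real (gaussian (?e *\<^sub>R \<zeta>)))
        = \<bar>inverse ?e\<bar> ^ DIM('a) *\<^sub>R (LINT \<eta>|lborel. cis ((0 + inverse ?e *\<^sub>R \<eta>) \<bullet> (z - w)) * complex_of_real (gaussian (?e *\<^sub>R (0 + inverse ?e *\<^sub>R \<eta>))))"
        using \<epsilon>[of n] by (intro lborel_integral_affine(2)) auto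
      also have "\<dots> = inverse ?e ^ N *\<^sub>R (LINT \<eta>|lborel. cis (\<eta> \<bullet> (inverse ?e *\<^sub>R (z - w))) * complex_of_real (gaussian \<eta>))"
        using \<epsilon>[of n] by (simp add: N_def)
      also have "\<dots> = complex_of_real (inverse ?e ^ N * sqrt (2 * pi) ^ N) * complex_of_real (gaussian (inverse ?e *\<^sub>R (z - w)))"
        by (subst gaussian_fourier(2)) (simp add: N_def scaleR_conv_of_real)
      finally show "(LINT \<zeta>|lborel. cis (\<zeta> \<bullet> (z - w)) * complex_of_real (gaussian (?e *\<^sub>R \<zeta>)) * h w)
          = complex_of_real (inverse ?e ^ N * sqrt (2 * pi) ^ N) * (complex_of_real (gaussian (inverse ?e *\<^sub>R (z - w))) * h w)"
        by (simp only: mult.assoc)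
    qed
    also have "\<dots> = complex_of_real (inverse ?e ^ N * sqrt (2 * pi) ^ N) * (LINT w|lborel. complex_of_real (gaussian (inverse ?e *\<^sub>R (z - w))) * h w)"
      by simp
    also have "(LINT w|lborel. complex_of_real (gaussian (inverse ?e *\<^sub>R (z - w))) * h w)
       = \<bar>?e\<bar> ^ DIM('a) *\<^sub>R (LINT v|lborel. complex_of_real (gaussian (inverse ?e *\<^sub>R (z - (z + ?e *\<^sub>R v)))) * h (z + ?e *\<^sub>R v))"
      using \<epsilon>[of n] by (intro lborel_integral_affine(2)) auto
    also have "\<dots> = complex_of_real (?e ^ N) * (LINT v|lborel. h (z + ?e *\<^sub>R v) * complex_of_real (gaussian v))"
      using \<epsilon>[of n] by (simp add: N_def scaleR_conv_of_real gaussian_def mult.commute)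
    also have "complex_of_real (inverse ?e ^ N * sqrt (2 * pi) ^ N) * (complex_of_real (?e ^ N) * (LINT v|lborel. h (z + ?e *\<^sub>R v) * complex_of_real (gaussian v)))
      = complex_of_real ((inverse ?e * ?e) ^ N) * (complex_of_real (sqrt (2 * pi) ^ N) * (LINT v|lborel. h (z + ?e *\<^sub>R v) * complex_of_real (gaussian v)))"
      by (simp only: power_mult_distrib of_real_mult mult_ac)
    also have "inverse ?e * ?e = 1" using \<epsilon>[of n] by simp
    finally show ?thesis by simp
  qed
  have "(\<lambda>n. LINT v|lborel. h (z + \<epsilon> n *\<^sub>R v) * complex_of_real (gaussian v))
      \<longlonglongrightarrow> (LINT v::'a|lborel. h z * complex_of_real (gaussian v))"
  proof (rule integral_dominated_convergence[where w="\<lambda>v::'a. M * gaussian v"])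
    show "AE v in lborel. (\<lambda>n. h (z + \<epsilon> n *\<^sub>R v) * complex_of_real (gaussian v)) \<longlonglongrightarrow> h z * complex_of_real (gaussian v)"
    proof (rule AE_I2, rule tendsto_mult[OF _ tendsto_const])
      fix v :: 'a
      have "(\<lambda>n. z + \<epsilon> n *\<^sub>R v) \<longlonglongrightarrow> z + 0 *\<^sub>R v" by (intro tendsto_intros \<epsilon>0)
      moreover have "isCont h (z + 0 *\<^sub>R v)" using cont by (simp add: continuous_on_eq_continuous_at)
      ultimately show "(\<lambda>n. h (z + \<epsilon> n *\<^sub>R v)) \<longlonglongrightarrow> h z"
        using isCont_tendsto_compose[of "z + 0 *\<^sub>R v" h] by simp
    qed
    show "AE v in lborel. norm (h (z + \<epsilon> n *\<^sub>R v) * complex_of_real (gaussian v)) \<le> M * gaussian v" for n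
      using g1 bdd by (auto simp: norm_mult intro!: mult_right_mono)
    show "integrable lborel (\<lambda>v::'a. M * gaussian v)"
      using integrable_norm[OF gint] g1 by simp
  qed auto
  then have "(\<lambda>n. complex_of_real (sqrt (2 * pi) ^ N) * (LINT v|lborel. h (z + \<epsilon> n *\<^sub>R v) * complex_of_real (gaussian v)))
      \<longlonglongrightarrow> complex_of_real (sqrt (2 * pi) ^ N) * (LINT v::'a|lborel. h z * complex_of_real (gaussian v))"
    by (rule tendsto_mult_left)
  then have "I \<longlonglongrightarrow> complex_of_real (sqrt (2 * pi) ^ N) * (LINT v::'a|lborel. h z * complex_of_real (gaussian v))"
    by (simp only: I_eq[abs_def])
  also have "complex_of_real (sqrt (2 * pi) ^ N) * (LINT v::'a|lborel. h z * complex_of_real (gaussian v))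
      = complex_of_real ((sqrt (2 * pi) * sqrt (2 * pi)) ^ N) * h z"
    unfolding integral_mult_right_zero gval power_mult_distrib of_real_mult by (simp only: mult_ac)
  also have "sqrt (2 * pi) * sqrt (2 * pi) = 2 * pi" by simp
  finally show ?thesis
    using lim1 LIMSEQ_unique unfolding N_def by blast
qed

section \<open>Decay of the Fourier transform\<close>

lemma bounded_support_integrable:
  fixes h :: "'a::euclidean_space \<Rightarrow> 'b::{banach, second_countable_topology}"
  assumes cont: "continuous_on UNIV h" and supp: "\<And>z. h z \<noteq> 0 \<Longrightarrow> norm z \<le> R"
  shows "integrable lborel h" and "\<exists>C. \<forall>z. norm (h z) \<le> C"
proof -
  have "integrable lborel (\<lambda>z. indicator (cball 0 R) z *\<^sub>R h z)"
    by (rule borel_integrable_compact) (use cont in \<open>auto intro: continuous_on_subset\<close>)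
  also have "(\<lambda>z. indicator (cball 0 R) z *\<^sub>R h z) = h"
    using supp by (auto simp: indicator_def fun_eq_iff)
  finally show "integrable lborel h" .
  have "bounded (h ` cball 0 R)"
    by (intro compact_imp_bounded compact_continuous_image continuous_on_subset[OF cont]) auto
  then obtain C where "\<forall>x\<in>cball 0 R. norm (h x) \<le> C" by (auto simp: bounded_iff)
  then have C: "norm (h z) \<le> C" if "norm z \<le> R" for z using that by simp
  have "norm (h z) \<le> max C 0" for z
    using C[of z] supp[of z] by (cases "h z = 0") auto
  then show "\<exists>C. \<forall>z. norm (h z) \<le> C" by blast
qed

lemma fourier_translate:
  fixes h :: "'a::euclidean_space \<Rightarrow> complex"
  assumes [measurable]: "h \<in> borel_measurable borel"
  shows "fourier (\<lambda>z. h (z + w)) \<zeta> = cis (\<zeta> \<bullet> w) * fourier h \<zeta>"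
proof -
  have "fourier h \<zeta> = (LINT z|lborel. cis (- (\<zeta> \<bullet> (w + z))) * h (w + z))"
    unfolding fourier_def by (subst lborel_integral_affine(2)[where c=1 and t=w]) simp_all
  also have "cis (\<zeta> \<bullet> w) * \<dots> = (LINT z|lborel. cis (\<zeta> \<bullet> w) * (cis (- (\<zeta> \<bullet> (w + z))) * h (w + z)))"
    by (rule integral_mult_right_zero[symmetric])
  also have "\<dots> = fourier (\<lambda>z. h (z + w)) \<zeta>"
    unfolding fourier_def
    by (intro Bochner_Integration.integral_cong refl) (simp add: cis_mult inner_add_right add.commute flip: mult.assoc)
  finally show ?thesis ..
qed

lemma fourier_diff:
  assumes "integrable lborel h" "integrable lborel g"
  shows "fourier (\<lambda>z. h z - g z) \<zeta> = fourier h \<zeta> - fourier g \<zeta>"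
  unfolding fourier_def right_diff_distrib
  by (rule Bochner_Integration.integral_diff) (intro integrable_cis_mult assms; measurable)+

lemma fourier_cmult: "fourier (\<lambda>z. c * h z) \<zeta> = c * fourier h \<zeta>"
  unfolding fourier_def by (simp add: mult.left_commute[of _ c])

lemma cis_difference_quotient:
  "(\<lambda>n. complex_of_real (real (Suc n)) * (cis (inverse (real (Suc n)) * a) - 1)) \<longlonglongrightarrow> \<i> * complex_of_real a"
proof -
  have "((\<lambda>w. exp (w * (\<i> * complex_of_real a))) has_field_derivative \<i> * complex_of_real a) (at 0)"
    by (auto intro!: derivative_eq_intros)
  then have lim: "((\<lambda>w. (exp (w * (\<i> * complex_of_real a)) - 1) / w) \<longlongrightarrow> \<i> * complex_of_real a) (at 0)"
    by (simp add: DERIV_def)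
  have f: "filterlim (\<lambda>n. complex_of_real (inverse (real (Suc n)))) (at 0) sequentially"
  proof -
    have "(\<lambda>n. complex_of_real (inverse (real (Suc n)))) \<longlonglongrightarrow> complex_of_real 0"
      by (intro tendsto_of_real LIMSEQ_inverse_real_of_nat)
    then show ?thesis by (auto simp: filterlim_at simp del: of_nat_Suc)
  qed
  have "(\<lambda>n. (exp (complex_of_real (inverse (real (Suc n))) * (\<i> * complex_of_real a)) - 1)
      / complex_of_real (inverse (real (Suc n)))) \<longlonglongrightarrow> \<i> * complex_of_real a"
    by (rule filterlim_compose[OF lim f])
  then show ?thesis
    by (simp add: cis_conv_exp field_simps del: of_nat_Suc)
qed

text \<open>
  A translation by \<open>\<tau> v\<close> multiplies the transform by \<open>cis (\<tau> (\<zeta> \<bullet> v))\<close>; dividing the increment by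
  \<open>\<tau>\<close> and letting \<open>\<tau>\<close> tend to 0 gives the rule without integration by parts. The mean value
  theorem bounds the difference quotients by the maximum of the derivative, on a ball that is
  enlarged by the largest shift.
\<close>

lemma fourier_derivative:
  fixes h :: "'a::euclidean_space \<Rightarrow> real"
  assumes der: "\<And>z. (h has_derivative (\<lambda>v. D v z)) (at z)"
    and contD: "continuous_on UNIV (D v)"
    and supp: "\<And>z. h z \<noteq> 0 \<Longrightarrow> norm z \<le> R" and suppD: "\<And>z. D v z \<noteq> 0 \<Longrightarrow> norm z \<le> R"
  shows "fourier (\<lambda>z. complex_of_real (D v z)) \<zeta>
    = \<i> * complex_of_real (\<zeta> \<bullet> v) * fourier (\<lambda>z. complex_of_real (h z)) \<zeta>"
proof -
  have cont: "continuous_on UNIV h"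
    using der by (auto intro!: has_derivative_continuous continuous_at_imp_continuous_on)
  have [measurable]: "h \<in> borel_measurable borel" "D v \<in> borel_measurable borel"
    using cont contD by (auto intro: borel_measurable_continuous_onI)
  obtain C where C: "\<And>z. \<bar>D v z\<bar> \<le> C"
    using bounded_support_integrable(2)[OF contD suppD] by auto
  then have C0: "C \<ge> 0" using abs_ge_zero order_trans by blast
  have hint: "integrable lborel h" by (rule bounded_support_integrable(1)[OF cont supp])
  define \<tau> where "\<tau> n = inverse (real (Suc n))" for n
  have \<tau>: "\<tau> n > 0" "\<tau> n \<le> 1" for n by (simp_all add: \<tau>_def field_simps)
  have \<tau>0: "\<tau> \<longlonglongrightarrow> 0" unfolding \<tau>_def[abs_def] by (rule LIMSEQ_inverse_real_of_nat)
  have der1: "((\<lambda>t. h (z + t *\<^sub>R v)) has_real_derivative D v (z + t *\<^sub>R v)) (at t)" for z t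
  proof -
    have "((\<lambda>t. h (z + t *\<^sub>R v)) has_derivative (\<lambda>s. D (s *\<^sub>R v) (z + t *\<^sub>R v))) (at t)"
      by (rule has_derivative_compose[of "\<lambda>t. z + t *\<^sub>R v", OF _ der]) (auto intro!: derivative_eq_intros)
    moreover have "D (s *\<^sub>R v) y = s * D v y" for s y
      using linear_scale[OF has_derivative_linear[OF der[of y]], of s v] by simp
    moreover have "(\<lambda>s. s * D v y) = (*) (D v y)" for y by (simp add: fun_eq_iff mult.commute)
    ultimately show ?thesis
      unfolding has_field_derivative_def by simp
  qed
  define q where "q n z = real (Suc n) * (h (z + \<tau> n *\<^sub>R v) - h z)" for n z
  have [measurable]: "q n \<in> borel_measurable borel" for n unfolding q_def by measurable
  have "(\<lambda>n. LINT z|lborel. cis (- (\<zeta> \<bullet> z)) * complex_of_real (q n z))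
      \<longlonglongrightarrow> (LINT z|lborel. cis (- (\<zeta> \<bullet> z)) * complex_of_real (D v z))"
  proof (rule integral_dominated_convergence[where w="\<lambda>z. C * indicator (cball 0 (R + norm v)) z"])
    have "integrable lborel (indicator (cball 0 (R + norm v)) :: 'a \<Rightarrow> real)"
      by (rule integrable_real_indicator) (simp_all only: sets_lborel borel_closed closed_cball emeasure_bounded_finite bounded_cball)
    then show "integrable lborel (\<lambda>z::'a. C * indicator (cball 0 (R + norm v)) z)"
      by (rule integrable_mult_right)
    show "AE z in lborel. (\<lambda>n. cis (- (\<zeta> \<bullet> z)) * complex_of_real (q n z))
        \<longlonglongrightarrow> cis (- (\<zeta> \<bullet> z)) * complex_of_real (D v z)"
    proof (rule AE_I2, intro tendsto_mult tendsto_const tendsto_of_real)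
      fix z
      have "((\<lambda>t. (h (z + t *\<^sub>R v) - h z) / t) \<longlongrightarrow> D v z) (at 0)"
        using der1[of z 0] by (simp add: DERIV_def)
      moreover have "filterlim \<tau> (at 0) sequentially"
        using \<tau>0 \<tau>(1) by (auto simp: filterlim_at less_imp_neq[symmetric] intro!: always_eventually)
      ultimately have "(\<lambda>n. (h (z + \<tau> n *\<^sub>R v) - h z) / \<tau> n) \<longlonglongrightarrow> D v z"
        by (rule filterlim_compose)
      then show "(\<lambda>n. q n z) \<longlonglongrightarrow> D v z"
        by (simp add: q_def \<tau>_def field_simps del: of_nat_Suc)
    qed
    show "AE z in lborel. norm (cis (- (\<zeta> \<bullet> z)) * complex_of_real (q n z))
        \<le> C * indicator (cball 0 (R + norm v)) z" for n
    proof (rule AE_I2)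
      fix z
      have sm: "norm (\<tau> n *\<^sub>R v) \<le> norm v"
        using \<tau>[of n] by (simp add: mult_left_le_one_le)
      show "norm (cis (- (\<zeta> \<bullet> z)) * complex_of_real (q n z)) \<le> C * indicator (cball 0 (R + norm v)) z"
      proof (cases "norm z \<le> R + norm v")
        case True
        have "\<exists>s>0. s < \<tau> n \<and> h (z + \<tau> n *\<^sub>R v) - h (z + 0 *\<^sub>R v) = (\<tau> n - 0) * D v (z + s *\<^sub>R v)"
          by (rule MVT2) (use \<tau> der1 in auto)
        then obtain s where "h (z + \<tau> n *\<^sub>R v) - h z = \<tau> n * D v (z + s *\<^sub>R v)" by auto
        then have "q n z = D v (z + s *\<^sub>R v)"
          by (simp add: q_def \<tau>_def)
        then show ?thesis using True C by (simp add: norm_mult)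
      next
        case False
        then have "\<not> norm z \<le> R" using norm_ge_zero[of v] by linarith
        moreover have "\<not> norm (z + \<tau> n *\<^sub>R v) \<le> R"
          using False sm norm_triangle_ineq2[of z "- (\<tau> n *\<^sub>R v)"] by simp
        ultimately have "h z = 0" "h (z + \<tau> n *\<^sub>R v) = 0" using supp by blast+
        then have "q n z = 0" by (simp add: q_def)
        then show ?thesis using C0 by simp
      qed
    qed
  qed auto
  moreover have "(LINT z|lborel. cis (- (\<zeta> \<bullet> z)) * complex_of_real (q n z))
      = complex_of_real (real (Suc n)) * (cis (\<tau> n * (\<zeta> \<bullet> v)) - 1) * fourier (\<lambda>z. complex_of_real (h z)) \<zeta>" for n
  proof -
    have "integrable lborel (\<lambda>z. h (\<tau> n *\<^sub>R v + 1 *\<^sub>R z))"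
      by (subst lborel_integral_affine(1)) (use hint in auto)
    then have int2: "integrable lborel (\<lambda>z. h (z + \<tau> n *\<^sub>R v))" by (simp add: add.commute)
    have "(LINT z|lborel. cis (- (\<zeta> \<bullet> z)) * complex_of_real (q n z))
      = fourier (\<lambda>z. complex_of_real (real (Suc n)) * (complex_of_real (h (z + \<tau> n *\<^sub>R v)) - complex_of_real (h z))) \<zeta>"
      by (simp add: fourier_def q_def del: of_nat_Suc)
    also have "\<dots> = complex_of_real (real (Suc n)) *
        (fourier (\<lambda>z. complex_of_real (h (z + \<tau> n *\<^sub>R v))) \<zeta> - fourier (\<lambda>z. complex_of_real (h z)) \<zeta>)"
      using hint int2 by (subst fourier_cmult, subst fourier_diff) auto
    also have "fourier (\<lambda>z. complex_of_real (h (z + \<tau> n *\<^sub>R v))) \<zeta>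
        = cis (\<zeta> \<bullet> \<tau> n *\<^sub>R v) * fourier (\<lambda>z. complex_of_real (h z)) \<zeta>"
      by (rule fourier_translate[where h="\<lambda>z. complex_of_real (h z)"]) measurable
    finally show ?thesis by (simp add: algebra_simps)
  qed
  ultimately have 1: "(\<lambda>n. complex_of_real (real (Suc n)) * (cis (\<tau> n * (\<zeta> \<bullet> v)) - 1) * fourier (\<lambda>z. complex_of_real (h z)) \<zeta>)
      \<longlonglongrightarrow> fourier (\<lambda>z. complex_of_real (D v z)) \<zeta>"
    by (simp add: fourier_def)
  have 2: "(\<lambda>n. complex_of_real (real (Suc n)) * (cis (\<tau> n * (\<zeta> \<bullet> v)) - 1) * fourier (\<lambda>z. complex_of_real (h z)) \<zeta>)
      \<longlonglongrightarrow> \<i> * complex_of_real (\<zeta> \<bullet> v) * fourier (\<lambda>z. complex_of_real (h z)) \<zeta>"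
    unfolding \<tau>_def by (intro tendsto_mult_right cis_difference_quotient)
  show ?thesis by (rule LIMSEQ_unique[OF 1 2])
qed

text \<open>
  Integrability of the transform follows from closure under differences and derivatives alone.
  Working with a class of functions instead of a general notion of smoothness avoids a
  calculus of higher derivatives for the concrete functions below.
\<close>

locale derivative_closed =
  fixes S :: "('a::euclidean_space \<Rightarrow> real) set"
  assumes bounded_support: "h \<in> S \<Longrightarrow> \<exists>R. \<forall>z. h z \<noteq> 0 \<longrightarrow> norm z \<le> R"
    and diff_closed: "h \<in> S \<Longrightarrow> g \<in> S \<Longrightarrow> (\<lambda>z. h z - g z) \<in> S"
    and derivative: "h \<in> S \<Longrightarrow> \<exists>D. (\<forall>z. (h has_derivative (\<lambda>v. D v z)) (at z)) \<and> (\<forall>v. D v \<in> S)"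
begin

lemma continuous: "h \<in> S \<Longrightarrow> continuous_on UNIV h"
  using derivative[of h] by (meson has_derivative_continuous continuous_at_imp_continuous_on)

lemma integrable: "h \<in> S \<Longrightarrow> integrable lborel h"
  using bounded_support_integrable(1)[OF continuous] bounded_support by blast

text \<open>
  Each factor \<open>1 + (\<zeta> \<bullet> b)\<^sup>2\<close> comes from applying \<open>1 - \<partial>\<^sub>b\<^sup>2\<close>, which stays in the class, and
  transforms are bounded.
\<close>

lemma fourier_decay:
  assumes "finite B" "h \<in> S"
  shows "\<exists>C. \<forall>\<zeta>. (\<Prod>b\<in>B. 1 + (\<zeta> \<bullet> b)\<^sup>2) * norm (fourier (\<lambda>z. complex_of_real (h z)) \<zeta>) \<le> C"
  using assms
proof (induction B arbitrary: h rule: finite_induct)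
  case empty
  show ?case
    by (rule exI[of _ "LINT z|lborel. norm (complex_of_real (h z))"]) (simp only: prod.empty mult_1 norm_fourier_le simp_thms)
next
  case (insert b B)
  have D: "\<exists>D. D \<in> S \<and> (\<forall>\<zeta>. fourier (\<lambda>z. complex_of_real (D z)) \<zeta>
      = \<i> * complex_of_real (\<zeta> \<bullet> b) * fourier (\<lambda>z. complex_of_real (g z)) \<zeta>)" if g: "g \<in> S" for g
  proof -
    obtain D where D: "\<And>z. (g has_derivative (\<lambda>v. D v z)) (at z)" "\<And>v. D v \<in> S"
      using derivative[OF g] by auto
    obtain R1 where R1: "\<And>z. g z \<noteq> 0 \<Longrightarrow> norm z \<le> R1" using bounded_support[OF g] by auto
    obtain R2 where R2: "\<And>z. D b z \<noteq> 0 \<Longrightarrow> norm z \<le> R2" using bounded_support[OF D(2)] by auto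
    have "fourier (\<lambda>z. complex_of_real (D b z)) \<zeta>
      = \<i> * complex_of_real (\<zeta> \<bullet> b) * fourier (\<lambda>z. complex_of_real (g z)) \<zeta>" for \<zeta>
      by (rule fourier_derivative[where R="max R1 R2", OF D(1) continuous[OF D(2)]])
         (use R1 R2 in \<open>force simp: le_max_iff_disj\<close>)+
    then show ?thesis using D(2) by blast
  qed
  obtain D1 where D1: "D1 \<in> S" "\<And>\<zeta>. fourier (\<lambda>z. complex_of_real (D1 z)) \<zeta>
      = \<i> * complex_of_real (\<zeta> \<bullet> b) * fourier (\<lambda>z. complex_of_real (h z)) \<zeta>"
    using D[OF insert.prems] by blast
  obtain D2 where D2: "D2 \<in> S" "\<And>\<zeta>. fourier (\<lambda>z. complex_of_real (D2 z)) \<zeta>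
      = \<i> * complex_of_real (\<zeta> \<bullet> b) * fourier (\<lambda>z. complex_of_real (D1 z)) \<zeta>"
    using D[OF D1(1)] by blast
  let ?g = "\<lambda>z. h z - D2 z"
  have g: "fourier (\<lambda>z. complex_of_real (?g z)) \<zeta>
      = complex_of_real (1 + (\<zeta> \<bullet> b)\<^sup>2) * fourier (\<lambda>z. complex_of_real (h z)) \<zeta>" for \<zeta>
  proof -
    have "fourier (\<lambda>z. complex_of_real (?g z)) \<zeta>
        = fourier (\<lambda>z. complex_of_real (h z)) \<zeta> - fourier (\<lambda>z. complex_of_real (D2 z)) \<zeta>"
      using integrable[OF insert.prems] integrable[OF D2(1)]
      by (simp add: fourier_diff)
    then show ?thesis by (simp add: D1(2) D2(2) power2_eq_square algebra_simps)
  qed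
  obtain C where "\<And>\<zeta>. (\<Prod>b\<in>B. 1 + (\<zeta> \<bullet> b)\<^sup>2) * norm (fourier (\<lambda>z. complex_of_real (?g z)) \<zeta>) \<le> C"
    using insert.IH[OF diff_closed[OF insert.prems D2(1)]] by blast
  moreover have "norm (complex_of_real (1 + (\<zeta> \<bullet> b)\<^sup>2)) = 1 + (\<zeta> \<bullet> b)\<^sup>2" for \<zeta>
    by (simp only: norm_of_real) simp
  ultimately have "\<And>\<zeta>. (\<Prod>b\<in>B. 1 + (\<zeta> \<bullet> b)\<^sup>2) * ((1 + (\<zeta> \<bullet> b)\<^sup>2) * norm (fourier (\<lambda>z. complex_of_real (h z)) \<zeta>)) \<le> C"
    by (simp only: g norm_mult)
  then show ?case
    using insert.hyps by (intro exI[of _ C]) (simp add: mult_ac)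
qed

lemma integrable_fourier:
  assumes h: "h \<in> S"
  shows "integrable lborel (fourier (\<lambda>z. complex_of_real (h z)))"
proof -
  obtain C where C: "\<And>\<zeta>. (\<Prod>b\<in>Basis. 1 + (\<zeta> \<bullet> b)\<^sup>2) * norm (fourier (\<lambda>z. complex_of_real (h z)) \<zeta>) \<le> C"
    using fourier_decay[OF finite_Basis h] by blast
  have "integrable lborel (\<lambda>x::real. inverse (1 + x\<^sup>2))"
    using integrable_inverse_1_plus_square by (simp add: set_integrable_def einterval_eq)
  then have "integrable lborel (\<lambda>\<zeta>::'a. \<Prod>b\<in>Basis. inverse (1 + (\<zeta> \<bullet> b)\<^sup>2))"
    by (rule lborel_integral_prod(1))
  then have I: "integrable lborel (\<lambda>\<zeta>::'a. C * (\<Prod>b\<in>Basis. inverse (1 + (\<zeta> \<bullet> b)\<^sup>2)))"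
    by (rule integrable_mult_right)
  have [measurable]: "h \<in> borel_measurable borel" using integrable[OF h] by simp
  show ?thesis
  proof (rule Bochner_Integration.integrable_bound[OF I])
    show "AE \<zeta> in lborel. norm (fourier (\<lambda>z. complex_of_real (h z)) \<zeta>)
        \<le> norm (C * (\<Prod>b\<in>Basis. inverse (1 + (\<zeta> \<bullet> b)\<^sup>2)))"
    proof (rule AE_I2)
      fix \<zeta> :: 'a
      let ?P = "\<Prod>b\<in>Basis. 1 + (\<zeta> \<bullet> b)\<^sup>2"
      have P: "?P > 0" by (intro prod_pos) (simp add: add_pos_nonneg)
      have "norm (fourier (\<lambda>z. complex_of_real (h z)) \<zeta>) \<le> C / ?P"
        using C[of \<zeta>] P by (simp add: field_simps)
      also have "\<dots> \<le> norm (C * (\<Prod>b\<in>Basis. inverse (1 + (\<zeta> \<bullet> b)\<^sup>2)))"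
        by (simp add: divide_inverse prod_inversef[unfolded comp_def, symmetric])
      finally show "norm (fourier (\<lambda>z. complex_of_real (h z)) \<zeta>)
        \<le> norm (C * (\<Prod>b\<in>Basis. inverse (1 + (\<zeta> \<bullet> b)\<^sup>2)))" .
    qed
  qed measurable
qed

end

section \<open>The radial lift of a function on the half-space\<close>

lemma Cc_upper_support:
  fixes g :: "'a::euclidean_space \<times> real \<Rightarrow> real"
  assumes "g \<in> Cc_infinity_upper"
  obtains a R where "a > 0" "\<And>u y. g (u, y) \<noteq> 0 \<Longrightarrow> a \<le> y \<and> norm (u, y) \<le> R"
proof -
  let ?K = "closure {z. g z \<noteq> 0}"
  have K: "compact ?K" "?K \<subseteq> UNIV \<times> {0<..}" using assms by (auto simp: Cc_infinity_upper_def)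
  obtain R where R: "\<And>z. z \<in> ?K \<Longrightarrow> norm z \<le> R"
    using compact_imp_bounded[OF K(1)] by (auto simp: bounded_iff)
  have "\<exists>a>0. \<forall>z\<in>?K. a \<le> snd z"
  proof (cases "?K = {}")
    case False
    have "\<exists>z\<in>?K. \<forall>w\<in>?K. snd z \<le> snd w"
      by (rule continuous_attains_inf[OF K(1) False]) (intro continuous_intros)
    then show ?thesis using K(2) by (metis greaterThan_iff mem_Times_iff subsetD)
  next
    case True
    have "\<forall>z\<in>?K. 1 \<le> snd z" unfolding True by simp
    then show ?thesis using zero_less_one by blast
  qed
  then obtain a where "a > 0" "\<forall>z\<in>?K. a \<le> snd z" by blast
  then show ?thesis
    using R closure_subset[of "{z. g z \<noteq> 0}"] by (intro that[of a R]) force+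
qed

text \<open>
  Outside the closed support a function vanishes on a neighbourhood, so directional
  derivatives do not enlarge the support.
\<close>

lemma Cc_upper_derivative:
  fixes g :: "'a::euclidean_space \<times> real \<Rightarrow> real"
  assumes g: "g \<in> Cc_infinity_upper"
  shows "(g has_derivative frechet_derivative g (at z)) (at z)"
    and "(\<lambda>z. frechet_derivative g (at z) v) \<in> Cc_infinity_upper"
proof -
  have C: "C_order n g" for n using g by (simp add: Cc_infinity_upper_def)
  show d: "(g has_derivative frechet_derivative g (at z)) (at z)" for z
    using C[of "Suc 0"] unfolding C_order.simps frechet_derivative_works by blast
  have "frechet_derivative g (at z) v = 0" if z: "z \<notin> closure {z. g z \<noteq> 0}" for z
  proof -
    have "(g has_derivative (\<lambda>v. 0)) (at z)"
    proof (rule has_derivative_transform_within_open[of "\<lambda>_. 0"])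
      show "open (- closure {z. g z \<noteq> 0})" by (simp add: open_closed)
      show "z \<in> - closure {z. g z \<noteq> 0}" using z by simp
      show "0 = g x" if "x \<in> - closure {z. g z \<noteq> 0}" for x
        using that closure_subset[of "{z. g z \<noteq> 0}"] by auto
    qed simp
    from frechet_derivative_at[OF this] show ?thesis by metis
  qed
  then have "{z. frechet_derivative g (at z) v \<noteq> 0} \<subseteq> closure {z. g z \<noteq> 0}" by auto
  then have sub: "closure {z. frechet_derivative g (at z) v \<noteq> 0} \<subseteq> closure {z. g z \<noteq> 0}"
    by (simp add: closure_minimal)
  moreover from this have "compact (closure {z. frechet_derivative g (at z) v \<noteq> 0})"
    using g compact_Int_closed[of "closure {z. g z \<noteq> 0}" "closure {z. frechet_derivative g (at z) v \<noteq> 0}"]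
    by (simp only: Cc_infinity_upper_def mem_Collect_eq inf.absorb2 closed_closure simp_thms)
  moreover have "C_order n (\<lambda>z. frechet_derivative g (at z) v)" for n
    using C[of "Suc n"] unfolding C_order.simps by blast
  ultimately show "(\<lambda>z. frechet_derivative g (at z) v) \<in> Cc_infinity_upper"
    using g by (auto simp: Cc_infinity_upper_def)
qed

text \<open>
  The smallest class that contains the lifts \<open>(u, w) \<mapsto> g (u, |w|) |w|\<^sup>\<alpha>\<close> and is closed under
  differentiation: differentiating \<open>|w|\<close> produces coordinates of \<open>w\<close> and lowers the
  exponent \<open>\<alpha>\<close>, which is why arbitrary real exponents and products with coordinates occur.
\<close>

inductive_set radial_lifts :: "('a::euclidean_space \<times> 'a \<Rightarrow> real) set" where
  lift: "g \<in> Cc_infinity_upper \<Longrightarrow>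
    (\<lambda>z. g (fst z, norm (snd z)) * norm (snd z) powr \<alpha>) \<in> radial_lifts"
| coordinate: "h \<in> radial_lifts \<Longrightarrow> (\<lambda>z. (snd z \<bullet> b) * h z) \<in> radial_lifts"
| add: "h \<in> radial_lifts \<Longrightarrow> g \<in> radial_lifts \<Longrightarrow> (\<lambda>z. h z + g z) \<in> radial_lifts"
| scale: "h \<in> radial_lifts \<Longrightarrow> (\<lambda>z. c * h z) \<in> radial_lifts"

lemma radial_lifts_bounded_support:
  assumes "h \<in> radial_lifts"
  shows "\<exists>R. \<forall>z. h z \<noteq> 0 \<longrightarrow> norm z \<le> R"
  using assms
proof induction
  case (lift g \<alpha>)
  obtain a R where "a > 0" and R: "\<And>u y. g (u, y) \<noteq> 0 \<Longrightarrow> a \<le> y \<and> norm (u, y) \<le> R"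
    using Cc_upper_support[OF lift] by metis
  have "norm z \<le> R" if "g (fst z, norm (snd z)) * norm (snd z) powr \<alpha> \<noteq> 0" for z
    using R[of "fst z" "norm (snd z)"] that by (cases z) (simp add: norm_Pair)
  then show ?case by blast
next
  case (add h g)
  then obtain R1 R2 where "\<And>z. h z \<noteq> 0 \<Longrightarrow> norm z \<le> R1" "\<And>z. g z \<noteq> 0 \<Longrightarrow> norm z \<le> R2" by blast
  then have "h z + g z \<noteq> 0 \<longrightarrow> norm z \<le> max R1 R2" for z
    by (metis add.right_neutral le_max_iff_disj)
  then show ?case by blast
qed auto

text \<open>
  Away from \<open>w = 0\<close> this is the chain rule. Near \<open>w = 0\<close> the lift vanishes identically, since
  \<open>g\<close> is supported where the last coordinate is at least some \<open>a > 0\<close>; at \<open>w = 0\<close>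
  the right-hand side is 0 because \<open>0 powr \<alpha> = 0\<close>.
\<close>

lemma radial_lifts_derivative_base:
  fixes g :: "'a::euclidean_space \<times> real \<Rightarrow> real" and z :: "'a \<times> 'a"
  assumes g: "g \<in> Cc_infinity_upper"
  defines "G \<equiv> \<lambda>v z. frechet_derivative g (at z) v"
  shows "((\<lambda>z. g (fst z, norm (snd z)) * norm (snd z) powr \<alpha>) has_derivative
    (\<lambda>v. G (fst v, 0) (fst z, norm (snd z)) * norm (snd z) powr \<alpha>
       + (snd z \<bullet> snd v) * (G (0, 1) (fst z, norm (snd z)) * norm (snd z) powr (\<alpha> - 1))
       + \<alpha> * ((snd z \<bullet> snd v) * (g (fst z, norm (snd z)) * norm (snd z) powr (\<alpha> - 2))))) (at z)"
proof (cases "snd z = 0")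
  case True
  obtain a R where a: "a > 0" and R: "\<And>u y. g (u, y) \<noteq> 0 \<Longrightarrow> a \<le> y \<and> norm (u, y) \<le> R"
    using Cc_upper_support[OF g] by metis
  have "((\<lambda>z. g (fst z, norm (snd z)) * norm (snd z) powr \<alpha>) has_derivative (\<lambda>v. 0)) (at z)"
  proof (rule has_derivative_transform_within_open[of "\<lambda>_. 0"])
    show "open {z :: 'a \<times> 'a. norm (snd z) < a}"
      by (intro open_Collect_less continuous_intros)
    show "z \<in> {z. norm (snd z) < a}" using True a by simp
    show "0 = g (fst x, norm (snd x)) * norm (snd x) powr \<alpha>" if "x \<in> {z. norm (snd z) < a}" for x
      using that R[of "fst x" "norm (snd x)"] by force
  qed simp
  then show ?thesis using True by simp
next
  case False
  define r where "r = norm (snd z)"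
  have r: "r > 0" using False by (simp add: r_def)
  have nd: "((\<lambda>z. norm (snd z)) has_derivative (\<lambda>v. (snd z \<bullet> snd v) / r)) (at z)"
  proof -
    have "((\<lambda>z. norm (snd z)) has_derivative (\<lambda>v. snd v \<bullet> sgn (snd z))) (at z)"
      using has_derivative_compose[OF has_derivative_snd[OF has_derivative_ident] has_derivative_norm[OF False]]
      by simp
    then show ?thesis by (simp add: sgn_div_norm r_def inner_commute divide_inverse mult.commute)
  qed
  have gd: "((\<lambda>z. g (fst z, norm (snd z))) has_derivative
      (\<lambda>v. G (fst v, (snd z \<bullet> snd v) / r) (fst z, r))) (at z)"
  proof -
    have "((\<lambda>z. (fst z, norm (snd z))) has_derivative (\<lambda>v. (fst v, (snd z \<bullet> snd v) / r))) (at z)"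
      by (intro has_derivative_Pair nd has_derivative_fst has_derivative_ident)
    from has_derivative_compose[OF this Cc_upper_derivative(1)[OF g]]
    show ?thesis by (simp add: G_def r_def)
  qed
  have pd: "((\<lambda>z. norm (snd z) powr \<alpha>) has_derivative (\<lambda>v. \<alpha> * r powr (\<alpha> - 1) * ((snd z \<bullet> snd v) / r))) (at z)"
  proof -
    have "((\<lambda>y. y powr \<alpha>) has_derivative (\<lambda>s. \<alpha> * r powr (\<alpha> - 1) * s)) (at r)"
      using has_real_derivative_powr[OF r, of \<alpha>] by (simp add: has_field_derivative_def)
    then have "((\<lambda>y. y powr \<alpha>) has_derivative (\<lambda>s. \<alpha> * r powr (\<alpha> - 1) * s)) (at (norm (snd z)))"
      by (simp add: r_def)
    from has_derivative_compose[OF nd this] show ?thesis .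
  qed
  have lin: "G (a, s) p = G (a, 0) p + s * G (0, 1) p" for a s p
  proof -
    have l: "linear (frechet_derivative g (at p))"
      by (rule has_derivative_linear[OF Cc_upper_derivative(1)[OF g]])
    have "(a, s) = (a, 0) + s *\<^sub>R (0, 1)" by simp
    then show ?thesis unfolding G_def using linear_add[OF l] linear_scale[OF l] by (metis real_scaleR_def)
  qed
  have p1: "r powr \<alpha> / r = r powr (\<alpha> - 1)" "r powr (\<alpha> - 1) / r = r powr (\<alpha> - 2)"
    using r by (simp_all add: powr_diff field_simps power2_eq_square)
  show ?thesis
    using has_derivative_mult[OF gd pd]
  proof (rule has_derivative_eq_rhs)
    show "(\<lambda>v. g (fst z, norm (snd z)) * (\<alpha> * r powr (\<alpha> - 1) * ((snd z \<bullet> snd v) / r))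
          + G (fst v, (snd z \<bullet> snd v) / r) (fst z, r) * norm (snd z) powr \<alpha>)
      = (\<lambda>v. G (fst v, 0) (fst z, norm (snd z)) * norm (snd z) powr \<alpha>
       + (snd z \<bullet> snd v) * (G (0, 1) (fst z, norm (snd z)) * norm (snd z) powr (\<alpha> - 1))
       + \<alpha> * ((snd z \<bullet> snd v) * (g (fst z, norm (snd z)) * norm (snd z) powr (\<alpha> - 2))))"
      unfolding r_def[symmetric] p1[symmetric]
      by (subst lin) (simp add: algebra_simps)
  qed
qed

lemma radial_lifts_derivative:
  assumes "h \<in> radial_lifts"
  shows "\<exists>D. (\<forall>z. (h has_derivative (\<lambda>v. D v z)) (at z)) \<and> (\<forall>v. D v \<in> radial_lifts)"
  using assms
proof induction
  case (lift g \<alpha>)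
  show ?case
    using radial_lifts_derivative_base[OF lift]
    by (intro exI conjI allI, assumption)
       (intro radial_lifts.intros Cc_upper_derivative(2) lift)
next
  case (coordinate h b)
  then obtain D where D: "\<And>z. (h has_derivative (\<lambda>v. D v z)) (at z)" "\<And>v. D v \<in> radial_lifts" by blast
  have "((\<lambda>z. (snd z \<bullet> b) * h z) has_derivative (\<lambda>v. (snd z \<bullet> b) * D v z + (snd v \<bullet> b) * h z)) (at z)" for z
    by (rule has_derivative_mult[OF _ D(1)]) (auto intro!: derivative_eq_intros)
  then show ?case
    by (intro exI[of _ "\<lambda>v z. (snd z \<bullet> b) * D v z + (snd v \<bullet> b) * h z"] conjI allI)
       (auto intro!: radial_lifts.intros D(2) coordinate)
next
  case (add h g)
  then obtain D E where D: "\<And>z. (h has_derivative (\<lambda>v. D v z)) (at z)" "\<And>v. D v \<in> radial_lifts"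
    and E: "\<And>z. (g has_derivative (\<lambda>v. E v z)) (at z)" "\<And>v. E v \<in> radial_lifts" by metis
  show ?case
    by (intro exI[of _ "\<lambda>v z. D v z + E v z"] conjI allI has_derivative_add D E radial_lifts.add)
next
  case (scale h c)
  then obtain D where D: "\<And>z. (h has_derivative (\<lambda>v. D v z)) (at z)" "\<And>v. D v \<in> radial_lifts" by blast
  show ?case
    by (intro exI[of _ "\<lambda>v z. c * D v z"] conjI allI has_derivative_mult_right D radial_lifts.scale)
qed

interpretation radial_lifts: derivative_closed "radial_lifts :: ('a::euclidean_space \<times> 'a \<Rightarrow> real) set"
proof
  fix h g :: "'a \<times> 'a \<Rightarrow> real" assume h: "h \<in> radial_lifts"
  show "\<exists>R. \<forall>z. h z \<noteq> 0 \<longrightarrow> norm z \<le> R"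
    by (rule radial_lifts_bounded_support[OF h])
  show "\<exists>D. (\<forall>z. (h has_derivative (\<lambda>v. D v z)) (at z)) \<and> (\<forall>v. D v \<in> radial_lifts)"
    by (rule radial_lifts_derivative[OF h])
  assume "g \<in> radial_lifts"
  then have "(\<lambda>z. h z + (- 1) * g z) \<in> radial_lifts"
    using h by (intro radial_lifts.add radial_lifts.scale)
  then show "(\<lambda>z. h z - g z) \<in> radial_lifts" by simp
qed

text \<open>
  The factor \<open>|w|\<^sup>-\<^sup>p\<close> absorbs the weight \<open>s\<^sup>-\<^sup>p\<close> of the conical Radon transform.
\<close>

definition radial_lift :: "real \<Rightarrow> ('a::euclidean_space \<times> real \<Rightarrow> real) \<Rightarrow> 'a \<times> 'a \<Rightarrow> real" where
  "radial_lift p f z = f (fst z, norm (snd z)) * norm (snd z) powr (- p)"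

abbreviation lift_fourier :: "real \<Rightarrow> ('a::euclidean_space \<times> real \<Rightarrow> real) \<Rightarrow> 'a \<times> 'a \<Rightarrow> complex" where
  "lift_fourier p f \<equiv> fourier (\<lambda>z. complex_of_real (radial_lift p f z))"

lemma radial_lift_in_radial_lifts: "f \<in> Cc_infinity_upper \<Longrightarrow> radial_lift p f \<in> radial_lifts"
  unfolding radial_lift_def[abs_def] by (rule radial_lifts.lift)

lemma radial_lift_facts:
  assumes f: "f \<in> Cc_infinity_upper"
  shows "continuous_on UNIV (radial_lift p f)"
    and "radial_lift p f \<in> borel_measurable borel"
    and "integrable lborel (radial_lift p f)"
    and "lift_fourier p f \<in> borel_measurable borel"
    and "integrable lborel (lift_fourier p f)"
proof -
  note F = radial_lift_in_radial_lifts[OF f, of p]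
  show c: "continuous_on UNIV (radial_lift p f)" by (rule radial_lifts.continuous[OF F])
  show m [measurable]: "radial_lift p f \<in> borel_measurable borel" by (rule borel_measurable_continuous_onI[OF c])
  show "integrable lborel (radial_lift p f)" by (rule radial_lifts.integrable[OF F])
  show "lift_fourier p f \<in> borel_measurable borel" by measurable
  show "integrable lborel (lift_fourier p f)" by (rule radial_lifts.integrable_fourier[OF F])
qed

text \<open>
  The lift depends on \<open>w\<close> only through \<open>|w|\<close>, hence is invariant under the reflection that maps
  \<open>\<xi>\<close> to \<open>\<xi>'\<close>, and so is its transform.
\<close>

lemma lift_fourier_radial:
  fixes k \<xi> \<xi>' :: "'a::euclidean_space"
  assumes f: "f \<in> Cc_infinity_upper" and eq: "norm \<xi> = norm \<xi>'"
  shows "lift_fourier p f (k, \<xi>) = lift_fourier p f (k, \<xi>')"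
proof -
  obtain T where T: "linear T" "\<And>w. norm (T w) = norm w" "\<And>w. T (T w) = w"
    "\<And>v w. T v \<bullet> T w = v \<bullet> w" "T \<xi> = \<xi>'"
    using reflection_between_equal_norms[OF eq] by metis
  define T2 where "T2 z = (fst z, T (snd z))" for z :: "'a \<times> 'a"
  have [measurable]: "radial_lift p f \<in> borel_measurable borel" by (rule radial_lift_facts(2)[OF f])
  have T2: "linear T2" "\<And>z. norm (T2 z) = norm z" "\<And>z. T2 (T2 z) = z"
    using T(1) by (auto intro!: linearI simp: T2_def linear_add linear_scale T norm_Pair norm_prod_def)
  have ip: "(k, \<xi>) \<bullet> T2 z = (k, \<xi>') \<bullet> z" for z
    using T(4)[of \<xi> "T (snd z)"] by (cases z) (simp add: T2_def T)
  have "lift_fourier p f (k, \<xi>) = (LINT z|lborel. cis (- ((k, \<xi>) \<bullet> T2 z)) * complex_of_real (radial_lift p f (T2 z)))"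
    unfolding fourier_def
    by (rule lborel_integral_norm_preserving_involution[OF T2, symmetric]) measurable
  also have "\<dots> = lift_fourier p f (k, \<xi>')"
    unfolding fourier_def ip by (simp add: radial_lift_def T2_def T)
  finally show ?thesis .
qed

section \<open>The conical Radon transform in Fourier space\<close>

lemma sheared_lift_facts:
  fixes f :: "'a::euclidean_space \<times> real \<Rightarrow> real"
  assumes f: "f \<in> Cc_infinity_upper" and t: "t \<ge> 0"
  shows "integrable lborel (\<lambda>z. radial_lift p f (fst z + t *\<^sub>R snd z, snd z))"
    and "integrable lborel (\<lambda>w. radial_lift p f (u + t *\<^sub>R w, w))"
proof -
  note c = radial_lift_facts(1)[OF f, of p]
  obtain R where R: "\<And>z. radial_lift p f z \<noteq> 0 \<Longrightarrow> norm z \<le> R"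
    using radial_lifts_bounded_support[OF radial_lift_in_radial_lifts[OF f, of p]] by blast
  have R2: "norm w \<le> R" if "radial_lift p f (u, w) \<noteq> 0" for u w
    using R[OF that] norm_snd_le[of w u] by linarith
  have R1: "norm u \<le> R" if "radial_lift p f (u, w) \<noteq> 0" for u w
    using R[OF that] norm_fst_le[of u w] by linarith
  show "integrable lborel (\<lambda>z. radial_lift p f (fst z + t *\<^sub>R snd z, snd z))"
  proof (rule bounded_support_integrable(1)[where R="(R + t * R) + R"])
    show "continuous_on UNIV (\<lambda>z. radial_lift p f (fst z + t *\<^sub>R snd z, snd z))"
      by (rule continuous_on_compose2[OF c]) (auto intro!: continuous_intros)
    fix z assume nz: "radial_lift p f (fst z + t *\<^sub>R snd z, snd z) \<noteq> 0"
    have "norm (fst z) = norm ((fst z + t *\<^sub>R snd z) - t *\<^sub>R snd z)" by simp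
    also have "\<dots> \<le> norm (fst z + t *\<^sub>R snd z) + norm (t *\<^sub>R snd z)" by (rule norm_triangle_ineq4)
    also have "\<dots> \<le> R + t * R"
      using R1[OF nz] R2[OF nz] t by (intro add_mono) (auto intro!: mult_left_mono)
    finally have "norm (fst z) \<le> R + t * R" .
    moreover have "norm (snd z) \<le> R" by (rule R2[OF nz])
    moreover have "norm z \<le> norm (fst z) + norm (snd z)"
      using norm_Pair_le[of "fst z" "snd z"] by simp
    ultimately show "norm z \<le> (R + t * R) + R" by linarith
  qed
  show "integrable lborel (\<lambda>w. radial_lift p f (u + t *\<^sub>R w, w))"
  proof (rule bounded_support_integrable(1)[where R=R])
    show "continuous_on UNIV (\<lambda>w. radial_lift p f (u + t *\<^sub>R w, w))"
      by (rule continuous_on_compose2[OF c]) (auto intro!: continuous_intros)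
  qed (rule R2)
qed

text \<open>
  The point of the cone at parameters \<open>s\<close> and \<open>n\<close> is \<open>(u + tan \<theta> w, |w|)\<close> with
  \<open>w = s cos \<theta> n\<close>. In the variable \<open>w\<close>, polar coordinates turn the integral over the
  cone into an integral of the lift over an affine subspace.
\<close>

lemma conical_radon_eq_lift_integral:
  fixes f :: "'a::euclidean_space \<times> real \<Rightarrow> real"
  assumes f: "f \<in> Cc_infinity_upper" and \<theta>: "\<theta> \<in> {0<..<pi/2}"
  shows "conical_radon p f u \<theta> = cos \<theta> powr (p - 1) * tan \<theta> ^ (DIM('a) - 1) *
    (LINT w|lborel. radial_lift p f (u + tan \<theta> *\<^sub>R w, w))"
proof -
  define m where "m = DIM('a) - 1"
  define c where "c = cos \<theta>"
  have c: "c > 0" using \<theta> by (auto simp: c_def intro: cos_gt_zero_pi)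
  have tc: "tan \<theta> * c = sin \<theta>" using c by (simp add: tan_def c_def)
  have t: "tan \<theta> \<ge> 0" using \<theta> by (simp add: tan_gt_zero less_imp_le)
  define h where "h w = radial_lift p f (u + tan \<theta> *\<^sub>R w, w)" for w
  have hint: "integrable lborel h" unfolding h_def by (rule sheared_lift_facts(2)[OF f t])
  define \<phi> where "\<phi> r = indicator {0<..} r *\<^sub>R (r ^ m *\<^sub>R (LINT n|sphere_measure. h (r *\<^sub>R n)))" for r :: real
  note P = polar_coordinates[OF hint, folded m_def]
  have [measurable]: "\<phi> \<in> borel_measurable borel"
    using P(1) unfolding set_integrable_def \<phi>_def[symmetric] by simp
  have "(LINT w|lborel. h w) = (LINT r|lborel. \<phi> r)"
    using P(2) by (simp add: set_lebesgue_integral_def \<phi>_def)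
  also have "\<dots> = \<bar>c\<bar> ^ DIM(real) *\<^sub>R (LINT s|lborel. \<phi> (0 + c *\<^sub>R s))"
    by (rule lborel_integral_affine(2)) (use c in auto)
  also have "\<dots> = c * (LINT s|lborel. \<phi> (c * s))" using c by simp
  finally have 1: "(LINT w|lborel. h w) = c * (LINT s|lborel. \<phi> (c * s))" .
  have 2: "c powr (p - 1) * tan \<theta> ^ m * c * \<phi> (c * s) = indicator {0<..} s *\<^sub>R (1 / s powr p *
        (LINT n|sphere_measure. f (u + (s * sin \<theta>) *\<^sub>R n, s * cos \<theta>) * (s * sin \<theta>) ^ m))" for s
  proof (cases "s > 0")
    case s: True
    have "(LINT n|sphere_measure. h ((c * s) *\<^sub>R n))
        = (LINT n|sphere_measure. f (u + (s * sin \<theta>) *\<^sub>R n, s * cos \<theta>) * (c * s) powr (- p))"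
    proof (rule integral_cong_AE)
      have [measurable]: "h \<in> borel_measurable borel" using hint by simp
      show "(\<lambda>n. h ((c * s) *\<^sub>R n)) \<in> borel_measurable sphere_measure" by measurable
      have e: "continuous_on UNIV f"
        using f unfolding Cc_infinity_upper_def by (auto dest: spec[of _ 0])
      have [measurable]: "(\<lambda>n. f (u + (s * sin \<theta>) *\<^sub>R n, s * cos \<theta>)) \<in> borel_measurable borel"
        by (intro borel_measurable_continuous_onI continuous_on_compose2[OF e]) (auto intro!: continuous_intros)
      show "(\<lambda>n. f (u + (s * sin \<theta>) *\<^sub>R n, s * cos \<theta>) * (c * s) powr (- p)) \<in> borel_measurable sphere_measure"
        by measurable
      show "AE n in sphere_measure. h ((c * s) *\<^sub>R n)
          = f (u + (s * sin \<theta>) *\<^sub>R n, s * cos \<theta>) * (c * s) powr (- p)"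
        using AE_sphere_measure_norm
      proof eventually_elim
        case (elim n)
        have "tan \<theta> *\<^sub>R ((c * s) *\<^sub>R n) = (s * sin \<theta>) *\<^sub>R n" by (simp add: tc[symmetric])
        moreover have "norm ((c * s) *\<^sub>R n) = c * s" using elim c s by simp
        ultimately show ?case
          unfolding h_def radial_lift_def fst_conv snd_conv by (simp only: c_def mult.commute)
      qed
    qed
    then have "c powr (p - 1) * tan \<theta> ^ m * c * \<phi> (c * s)
      = (c powr (p - 1) * c * (c * s) powr (- p)) * (tan \<theta> * (c * s)) ^ m *
        (LINT n|sphere_measure. f (u + (s * sin \<theta>) *\<^sub>R n, s * cos \<theta>))"
      using s c by (simp add: \<phi>_def power_mult_distrib)
    also have "c powr (p - 1) * c * (c * s) powr (- p) = 1 / s powr p"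
      using s c by (simp add: powr_diff powr_minus powr_mult field_simps)
    also have "tan \<theta> * (c * s) = s * sin \<theta>" by (simp add: tc[symmetric])
    finally show ?thesis using s by simp
  next
    case False
    then show ?thesis using c by (simp add: \<phi>_def zero_less_mult_iff)
  qed
  have "conical_radon p f u \<theta> = (LINT s|lborel. c powr (p - 1) * tan \<theta> ^ m * c * \<phi> (c * s))"
    unfolding conical_radon_def set_lebesgue_integral_def m_def[symmetric] 2 ..
  also have "\<dots> = c powr (p - 1) * tan \<theta> ^ m * (LINT w|lborel. h w)"
    unfolding 1 by (simp add: mult.assoc)
  finally show ?thesis unfolding c_def h_def m_def .
qed

text \<open>
  The projection-slice theorem: shearing \<open>(u, w)\<close> to \<open>(u + t w, w)\<close> moves the frequency
  \<open>(k, 0)\<close> to \<open>(k, - t k)\<close>.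
\<close>

lemma fourier_conical_radon:
  fixes f :: "'a::euclidean_space \<times> real \<Rightarrow> real"
  assumes f: "f \<in> Cc_infinity_upper" and \<theta>: "\<theta> \<in> {0<..<pi/2}"
  shows "fourier_fst (\<lambda>u \<theta>. complex_of_real (conical_radon p f u \<theta>)) k \<theta>
    = complex_of_real (cos \<theta> powr (p - 1) * tan \<theta> ^ (DIM('a) - 1)) * lift_fourier p f (k, - tan \<theta> *\<^sub>R k)"
proof -
  define t where "t = tan \<theta>"
  have t: "t \<ge> 0" using \<theta> by (simp add: t_def tan_gt_zero less_imp_le)
  let ?F = "\<lambda>z. complex_of_real (radial_lift p f z)"
  have [measurable]: "radial_lift p f \<in> borel_measurable borel" by (rule radial_lift_facts(2)[OF f])
  let ?c = "complex_of_real (cos \<theta> powr (p - 1) * tan \<theta> ^ (DIM('a) - 1))"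
  have I1: "integrable (lborel \<Otimes>\<^sub>M lborel) (\<lambda>(u, w). cis (- (k \<bullet> u)) * ?F (u + t *\<^sub>R w, w))"
  proof -
    have "integrable lborel (\<lambda>z. ?F (fst z + t *\<^sub>R snd z, snd z))"
      using sheared_lift_facts(1)[OF f t] by simp
    then have "integrable lborel (\<lambda>z. cis (- (k \<bullet> fst z)) * ?F (fst z + t *\<^sub>R snd z, snd z))"
      by (rule integrable_cis_mult) (simp add: borel_prod[symmetric])
    then show ?thesis by (simp add: lborel_prod case_prod_unfold)
  qed
  have I2: "integrable (lborel \<Otimes>\<^sub>M lborel) (\<lambda>(u, w). cis (- ((k, - t *\<^sub>R k) \<bullet> (u, w))) * ?F (u, w))"
  proof -
    have "integrable lborel (\<lambda>z. cis (- ((k, - t *\<^sub>R k) \<bullet> z)) * ?F z)"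
      by (rule integrable_cis_mult) (use radial_lift_facts(3)[OF f] in simp_all)
    then show ?thesis by (simp add: lborel_prod case_prod_unfold inner_prod_def)
  qed
  have "fourier_fst (\<lambda>u \<theta>. complex_of_real (conical_radon p f u \<theta>)) k \<theta>
      = (LINT u|lborel. ?c * (cis (- (k \<bullet> u)) * (LINT w|lborel. ?F (u + t *\<^sub>R w, w))))"
    unfolding fourier_fst_def conical_radon_eq_lift_integral[OF f \<theta>] t_def[symmetric]
    by (intro Bochner_Integration.integral_cong refl) (simp add: cis_conv_exp mult_ac)
  also have "\<dots> = ?c * (LINT u|lborel. LINT w|lborel. cis (- (k \<bullet> u)) * ?F (u + t *\<^sub>R w, w))"
    by simp
  also have "(LINT u|lborel. LINT w|lborel. cis (- (k \<bullet> u)) * ?F (u + t *\<^sub>R w, w))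
      = (LINT w|lborel. LINT u|lborel. cis (- (k \<bullet> u)) * ?F (u + t *\<^sub>R w, w))"
    by (rule lborel_pair.Fubini_integral[OF I1, symmetric])
  also have "\<dots> = (LINT w|lborel. LINT u|lborel. cis (- ((k, - t *\<^sub>R k) \<bullet> (u, w))) * ?F (u, w))"
  proof (rule Bochner_Integration.integral_cong[OF refl])
    fix w :: 'a
    have "(LINT u|lborel. cis (- ((k, - t *\<^sub>R k) \<bullet> (u, w))) * ?F (u, w))
      = \<bar>1\<bar> ^ DIM('a) *\<^sub>R (LINT u|lborel. cis (- ((k, - t *\<^sub>R k) \<bullet> (t *\<^sub>R w + 1 *\<^sub>R u, w))) * ?F (t *\<^sub>R w + 1 *\<^sub>R u, w))"
      by (rule lborel_integral_affine(2)) (simp_all add: borel_prod[symmetric])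
    also have "\<dots> = (LINT u|lborel. cis (- (k \<bullet> u)) * ?F (u + t *\<^sub>R w, w))"
      by (simp add: inner_add_right add.commute)
    finally show "(LINT u|lborel. cis (- (k \<bullet> u)) * ?F (u + t *\<^sub>R w, w))
        = (LINT u|lborel. cis (- ((k, - t *\<^sub>R k) \<bullet> (u, w))) * ?F (u, w))" ..
  qed
  also have "\<dots> = (LINT z|(lborel \<Otimes>\<^sub>M lborel). (\<lambda>(u, w). cis (- ((k, - t *\<^sub>R k) \<bullet> (u, w))) * ?F (u, w)) z)"
    using lborel_pair.integral_snd[OF I2] by simp
  also have "\<dots> = lift_fourier p f (k, - t *\<^sub>R k)"
    by (simp add: lborel_prod fourier_def case_prod_unfold inner_prod_def)
  finally show ?thesis unfolding t_def .
qed

lemma riesz_conical_eq: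
  fixes f :: "'a::euclidean_space \<times> real \<Rightarrow> real"
  assumes f: "f \<in> Cc_infinity_upper" and \<theta>: "\<theta> \<in> {0<..<pi/2}"
  shows "riesz_conical p f u \<theta>
    = complex_of_real (cos \<theta> powr (p - 1) * tan \<theta> ^ (DIM('a) - 1) / (2 * pi) ^ DIM('a)) *
      (LINT k|lborel. complex_of_real (norm k ^ DIM('a)) * (cis (k \<bullet> u) * lift_fourier p f (k, - tan \<theta> *\<^sub>R k)))"
proof -
  let ?c = "complex_of_real (cos \<theta> powr (p - 1) * tan \<theta> ^ (DIM('a) - 1))"
  have "riesz_conical p f u \<theta> = complex_of_real (1 / (2 * pi) ^ DIM('a)) *
      (LINT k|lborel. ?c * (complex_of_real (norm k ^ DIM('a)) * (cis (k \<bullet> u) * lift_fourier p f (k, - tan \<theta> *\<^sub>R k))))"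
    unfolding riesz_conical_def riesz_potential_def fourier_conical_radon[OF f \<theta>] cis_conv_exp
    by (simp only: mult_ac)
  then show ?thesis unfolding integral_mult_right_zero by simp
qed

text \<open>
  The Fourier integrands at different points differ by a factor of modulus 1. Hence either all
  of them are integrable, and the potential is bounded and measurable, or none is, and the
  potential is the default value 0 everywhere.
\<close>

lemma integrable_riesz_potential_sphere:
  fixes g :: "'a::euclidean_space \<Rightarrow> real \<Rightarrow> complex"
  shows "integrable sphere_measure (\<lambda>n. riesz_potential g (x + r *\<^sub>R n) \<theta>)"
proof -
  define W where "W k = complex_of_real (norm k ^ DIM('a)) * fourier_fst g k \<theta>" for k
  have eq: "riesz_potential g u \<theta> = complex_of_real (1 / (2 * pi) ^ DIM('a)) * (LINT k|lborel. cis (k \<bullet> u) * W k)" for u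
    by (simp add: riesz_potential_def W_def cis_conv_exp mult_ac)
  show ?thesis
  proof (cases "integrable lborel W")
    case True
    then have [measurable]: "W \<in> borel_measurable borel" by simp
    have "integrable sphere_measure (\<lambda>n. LINT k|lborel. cis (k \<bullet> (x + r *\<^sub>R n)) * W k)"
    proof (rule sphere_measure.integrable_const_bound[where B="LINT k|lborel. norm (W k)"])
      show "AE n in sphere_measure. norm (LINT k|lborel. cis (k \<bullet> (x + r *\<^sub>R n)) * W k) \<le> (LINT k|lborel. norm (W k))"
        by (intro AE_I2 order_trans[OF integral_norm_bound]) (simp add: norm_mult)
    qed measurable
    then show ?thesis unfolding eq by (rule integrable_mult_right)
  next
    case False
    have "\<not> integrable lborel (\<lambda>k. cis (k \<bullet> u) * W k)" for u
    proof
      assume "integrable lborel (\<lambda>k. cis (k \<bullet> u) * W k)"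
      then have "integrable lborel (\<lambda>k. cis (- (k \<bullet> u)) * (cis (k \<bullet> u) * W k))"
        by (rule integrable_cis_mult) measurable
      then show False using False by (simp add: cis_mult flip: mult.assoc)
    qed
    then show ?thesis unfolding eq by (simp add: not_integrable_integral_eq)
  qed
qed

section \<open>Back projection\<close>

lemma set_lborel_integral_substitution_tan:
  fixes \<phi> :: "real \<Rightarrow> 'b::euclidean_space"
  assumes y: "y > 0" and int: "set_integrable lborel {0<..} \<phi>"
  shows "set_integrable lborel {0<..<pi/2} (\<lambda>\<theta>. (y / (cos \<theta>)\<^sup>2) *\<^sub>R \<phi> (y * tan \<theta>))"
    and "(LINT \<theta>:{0<..<pi/2}|lborel. (y / (cos \<theta>)\<^sup>2) *\<^sub>R \<phi> (y * tan \<theta>)) = (LINT r:{0<..}|lborel. \<phi> r)"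
proof -
  let ?S = "{0<..<pi/2}"
  let ?\<psi> = "\<lambda>\<theta>. \<bar>y / (cos \<theta>)\<^sup>2\<bar> *\<^sub>R \<phi> (y * tan \<theta>)"
  have [measurable]: "(\<lambda>r. indicator {0<..} r *\<^sub>R \<phi> r) \<in> borel_measurable borel"
    using int by (simp add: set_integrable_def)
  have cpos: "cos \<theta> > 0" if "\<theta> \<in> ?S" for \<theta>
    using that by (auto intro: cos_gt_zero_pi)
  have tpos: "tan \<theta> > 0" if "\<theta> \<in> ?S" for \<theta>
    using that by (auto intro: tan_gt_zero)
  have img: "(\<lambda>\<theta>. y * tan \<theta>) ` ?S = {0<..}"
  proof
    show "(\<lambda>\<theta>. y * tan \<theta>) ` ?S \<subseteq> {0<..}" using y tpos by auto
    show "{0<..} \<subseteq> (\<lambda>\<theta>. y * tan \<theta>) ` ?S"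
    proof
      fix r :: real assume "r \<in> {0<..}"
      then have r: "r > 0" by simp
      have "r = y * tan (arctan (r / y))" using y by (simp add: tan_arctan)
      moreover have "arctan (r / y) \<in> ?S" using y r arctan_ubound[of "r / y"] by simp
      ultimately show "r \<in> (\<lambda>\<theta>. y * tan \<theta>) ` ?S" by blast
    qed
  qed
  have inj: "inj_on (\<lambda>\<theta>. y * tan \<theta>) ?S"
  proof (rule inj_onI)
    fix a b assume ab: "a \<in> ?S" "b \<in> ?S" "y * tan a = y * tan b"
    then have "arctan (tan a) = arctan (tan b)" using y by simp
    then show "a = b" using ab by (simp add: arctan_tan)
  qed
  have der: "((\<lambda>\<theta>. y * tan \<theta>) has_field_derivative y / (cos \<theta>)\<^sup>2) (at \<theta> within ?S)" if "\<theta> \<in> ?S" for \<theta>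
    unfolding divide_inverse
    by (rule has_field_derivative_at_within, rule DERIV_cmult, rule DERIV_tan) (use cpos[OF that] in simp)
  have intL: "set_integrable lebesgue {0<..} \<phi>"
    using int unfolding set_integrable_def by (subst integrable_completion) auto
  have eqL: "(LINT r:{0<..}|lborel. \<phi> r) = integral {0<..} \<phi>"
    unfolding set_lebesgue_integral_eq_integral(2)[OF intL, symmetric] set_lebesgue_integral_def
    by (rule integral_completion[symmetric]) simp
  have main: "?\<psi> absolutely_integrable_on ?S" "integral ?S ?\<psi> = integral {0<..} \<phi>"
    using has_absolute_integral_change_of_variables_real[of ?S "\<lambda>\<theta>. y * tan \<theta>" "\<lambda>\<theta>. y / (cos \<theta>)\<^sup>2" \<phi> "integral {0<..} \<phi>"]
      der inj intL by (simp_all add: img)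
  have meas: "(\<lambda>\<theta>. indicator ?S \<theta> *\<^sub>R ?\<psi> \<theta>) \<in> borel_measurable borel"
  proof -
    have "(\<lambda>\<theta>. indicator ?S \<theta> *\<^sub>R ?\<psi> \<theta>)
        = (\<lambda>\<theta>. (indicator ?S \<theta> * \<bar>y / (cos \<theta>)\<^sup>2\<bar>) *\<^sub>R (indicator {0<..} (y * (sin \<theta> / cos \<theta>)) *\<^sub>R \<phi> (y * (sin \<theta> / cos \<theta>))))"
    proof
      fix \<theta>
      show "indicator ?S \<theta> *\<^sub>R ?\<psi> \<theta>
        = (indicator ?S \<theta> * \<bar>y / (cos \<theta>)\<^sup>2\<bar>) *\<^sub>R (indicator {0<..} (y * (sin \<theta> / cos \<theta>)) *\<^sub>R \<phi> (y * (sin \<theta> / cos \<theta>)))"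
      proof (cases "\<theta> \<in> ?S")
        case True
        have "y * (sin \<theta> / cos \<theta>) \<in> {0<..}"
          using mult_pos_pos[OF y tpos[OF True]] unfolding tan_def by (rule greaterThan_iff[THEN iffD2])
        then show ?thesis
          using True by (simp only: tan_def indicator_simps mult_1 scaleR_one)
      next
        case False
        then have "indicator ?S \<theta> = (0 :: real)" by (rule indicator_simps(2))
        then show ?thesis by (simp only: mult_zero_left scaleR_zero_left)
      qed
    qed
    also have "\<dots> \<in> borel_measurable borel"
      by (intro borel_measurable_scaleR measurable_compose[OF _ \<open>(\<lambda>r. indicator {0<..} r *\<^sub>R \<phi> r) \<in> borel_measurable borel\<close>]) measurable
    finally show ?thesis .
  qed
  have "set_integrable lborel ?S ?\<psi>"
    using main(1) meas unfolding set_integrable_def by (subst (asm) integrable_completion) auto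
  then show "set_integrable lborel ?S (\<lambda>\<theta>. (y / (cos \<theta>)\<^sup>2) *\<^sub>R \<phi> (y * tan \<theta>))"
    using y by simp
  have "(LINT \<theta>:?S|lborel. ?\<psi> \<theta>) = (LINT \<theta>:?S|lebesgue. ?\<psi> \<theta>)"
    unfolding set_lebesgue_integral_def by (rule integral_completion[symmetric]) (use meas in simp)
  also have "\<dots> = (LINT r:{0<..}|lborel. \<phi> r)"
    unfolding set_lebesgue_integral_eq_integral(2)[OF main(1)] main(2) eqL ..
  finally show "(LINT \<theta>:?S|lborel. (y / (cos \<theta>)\<^sup>2) *\<^sub>R \<phi> (y * tan \<theta>)) = (LINT r:{0<..}|lborel. \<phi> r)"
    using y by simp
qed

text \<open>
  The Fourier integrand of the filtered data at the point \<open>x + v\<close> and the angle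
  \<open>arctan (|v| / y)\<close>, up to factors that are independent of the frequency \<open>k\<close>.
\<close>

definition backprojection_kernel ::
    "real \<Rightarrow> ('a::euclidean_space \<times> real \<Rightarrow> real) \<Rightarrow> 'a \<Rightarrow> real \<Rightarrow> 'a \<Rightarrow> 'a \<Rightarrow> complex" where
  "backprojection_kernel p f x y k v =
    complex_of_real (norm k ^ DIM('a)) * (cis (k \<bullet> (x + v)) * lift_fourier p f (k, - (norm v / y) *\<^sub>R k))"

text \<open>
  The substitution \<open>v = y w / |k|\<close> has Jacobian \<open>y\<^sup>m |k|\<^sup>-\<^sup>m\<close>, which cancels the multiplier of the
  Riesz potential. Radiality first replaces the frequency \<open>- (|v| / y) k\<close> by \<open>w\<close>, both having norm
  \<open>|w|\<close>, and then lets a reflection turn the direction \<open>k / |k|\<close> in the phase into a fixed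
  unit vector \<open>e\<close>.
\<close>

lemma kernel_substitution:
  fixes k e :: "'a::euclidean_space"
  assumes f: "f \<in> Cc_infinity_upper" and y: "y > 0" and k: "k \<noteq> 0" and e: "norm e = 1"
    and ik: "integrable lborel (\<lambda>w. lift_fourier p f (k, w))"
  shows "integrable lborel (backprojection_kernel p f x y k)"
    and "(LINT v|lborel. norm (backprojection_kernel p f x y k v))
      = y ^ DIM('a) * (LINT w|lborel. norm (lift_fourier p f (k, w)))"
    and "(LINT v|lborel. backprojection_kernel p f x y k v) = complex_of_real (y ^ DIM('a)) *
      (LINT w|lborel. cis (k \<bullet> x + w \<bullet> (y *\<^sub>R e)) * lift_fourier p f (k, w))"
proof -
  let ?H = "lift_fourier p f"
  define m where "m = DIM('a)"
  have nk: "norm k > 0" using k by simp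
  define s where "s = y / norm k"
  have s: "s > 0" using y nk by (simp add: s_def)
  have sm: "s ^ m * norm k ^ m = y ^ m" using nk by (simp add: s_def power_divide)
  have [measurable]: "?H \<in> borel_measurable borel" by (rule radial_lift_facts(4)[OF f])
  have [measurable]: "backprojection_kernel p f x y k \<in> borel_measurable borel"
  proof -
    have "(\<lambda>v. ?H (k, - (norm v / y) *\<^sub>R k)) \<in> borel_measurable borel"
      by (rule measurable_compose[OF _ radial_lift_facts(4)[OF f]]) (simp add: borel_prod[symmetric])
    moreover have "(\<lambda>v. cis (k \<bullet> (x + v))) \<in> borel_measurable borel" by measurable
    ultimately show ?thesis
      unfolding backprojection_kernel_def[abs_def] by (intro borel_measurable_times borel_measurable_const)
  qed
  have [measurable]: "(\<lambda>w. ?H (k, w)) \<in> borel_measurable borel" using ik by simp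
  have ker: "backprojection_kernel p f x y k (0 + s *\<^sub>R w)
      = complex_of_real (norm k ^ m) * (cis (k \<bullet> x + w \<bullet> (y *\<^sub>R (k /\<^sub>R norm k))) * ?H (k, w))" for w
  proof -
    \<comment> \<open>The scale \<open>s = y / |k|\<close> is chosen such that both frequencies have the same norm.\<close>
    have "norm (- (norm (s *\<^sub>R w) / y) *\<^sub>R k) = norm w"
      using s y nk by (simp add: s_def)
    then have "?H (k, - (norm (s *\<^sub>R w) / y) *\<^sub>R k) = ?H (k, w)" by (rule lift_fourier_radial[OF f])
    moreover have "k \<bullet> (x + s *\<^sub>R w) = k \<bullet> x + w \<bullet> (y *\<^sub>R (k /\<^sub>R norm k))"
      by (simp add: inner_add_right s_def inner_commute divide_inverse)
    ultimately show ?thesis unfolding backprojection_kernel_def m_def by simp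
  qed
  have "integrable lborel (\<lambda>w. backprojection_kernel p f x y k (0 + s *\<^sub>R w))"
    unfolding ker by (intro integrable_mult_right integrable_cis_mult ik) measurable
  then show "integrable lborel (backprojection_kernel p f x y k)"
    by (subst (asm) lborel_integral_affine(1)) (use s in auto)
  have "(LINT v|lborel. norm (backprojection_kernel p f x y k v))
      = \<bar>s\<bar> ^ DIM('a) *\<^sub>R (LINT w|lborel. norm (backprojection_kernel p f x y k (0 + s *\<^sub>R w)))"
    by (rule lborel_integral_affine(2)) (use s in auto)
  also have "\<dots> = (s ^ m * norm k ^ m) * (LINT w|lborel. norm (?H (k, w)))"
    unfolding ker using s by (simp add: norm_mult norm_power m_def)
  finally show "(LINT v|lborel. norm (backprojection_kernel p f x y k v))
      = y ^ DIM('a) * (LINT w|lborel. norm (?H (k, w)))"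
    unfolding sm unfolding m_def .
  have ke: "norm (k /\<^sub>R norm k) = norm e" using k e by simp
  obtain T where T: "linear T" "\<And>w. norm (T w) = norm w" "\<And>w. T (T w) = w"
    "\<And>v w. T v \<bullet> T w = v \<bullet> w" "T (k /\<^sub>R norm k) = e"
    using reflection_between_equal_norms[OF ke] by metis
  have "(LINT v|lborel. backprojection_kernel p f x y k v)
      = \<bar>s\<bar> ^ DIM('a) *\<^sub>R (LINT w|lborel. backprojection_kernel p f x y k (0 + s *\<^sub>R w))"
    by (rule lborel_integral_affine(2)) (use s in auto)
  also have "\<dots> = complex_of_real (s ^ m * norm k ^ m) *
      (LINT w|lborel. cis (k \<bullet> x + w \<bullet> (y *\<^sub>R (k /\<^sub>R norm k))) * ?H (k, w))"
    unfolding ker using s by (simp add: m_def scaleR_conv_of_real)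
  also have "(LINT w|lborel. cis (k \<bullet> x + w \<bullet> (y *\<^sub>R (k /\<^sub>R norm k))) * ?H (k, w))
      = (LINT w|lborel. cis (k \<bullet> x + T w \<bullet> (y *\<^sub>R (k /\<^sub>R norm k))) * ?H (k, T w))"
    by (rule lborel_integral_norm_preserving_involution[OF T(1-3), symmetric]) measurable
  also have "\<dots> = (LINT w|lborel. cis (k \<bullet> x + w \<bullet> (y *\<^sub>R e)) * ?H (k, w))"
  proof (rule Bochner_Integration.integral_cong[OF refl])
    fix w
    have "T w \<bullet> (k /\<^sub>R norm k) = w \<bullet> e" using T(4)[of "T w" "k /\<^sub>R norm k"] by (simp only: T(3,5))
    moreover have "?H (k, T w) = ?H (k, w)" by (rule lift_fourier_radial[OF f]) (rule T)
    ultimately show "cis (k \<bullet> x + T w \<bullet> (y *\<^sub>R (k /\<^sub>R norm k))) * ?H (k, T w)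
        = cis (k \<bullet> x + w \<bullet> (y *\<^sub>R e)) * ?H (k, w)"
      by (simp only: inner_scaleR_right)
  qed
  finally show "(LINT v|lborel. backprojection_kernel p f x y k v) = complex_of_real (y ^ DIM('a)) *
      (LINT w|lborel. cis (k \<bullet> x + w \<bullet> (y *\<^sub>R e)) * ?H (k, w))"
    unfolding sm unfolding m_def .
qed

text \<open>
  After the substitution the double integral is the Fourier inversion integral of the
  lift at \<open>(x, y e)\<close>, where the lift equals \<open>y\<^sup>-\<^sup>p f (x, y)\<close>. Integrability of the transform is what
  allows the order of integration to be exchanged.
\<close>

lemma kernel_integral:
  fixes f :: "'a::euclidean_space \<times> real \<Rightarrow> real"
  assumes f: "f \<in> Cc_infinity_upper" and y: "y > 0"
  shows "integrable lborel (\<lambda>v. LINT k|lborel. backprojection_kernel p f x y k v)"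
    and "(LINT v|lborel. LINT k|lborel. backprojection_kernel p f x y k v)
      = complex_of_real (y ^ DIM('a) * y powr (- p) * ((2 * pi) ^ DIM('a) * (2 * pi) ^ DIM('a))) * complex_of_real (f (x, y))"
proof -
  let ?H = "lift_fourier p f"
  let ?J = "backprojection_kernel p f x y"
  obtain e :: 'a where e: "norm e = 1" by (metis SOME_Basis norm_Basis)
  have [measurable]: "?H \<in> borel_measurable (borel \<Otimes>\<^sub>M borel)"
    using radial_lift_facts(4)[OF f] by (simp add: borel_prod)
  have H: "integrable (lborel \<Otimes>\<^sub>M lborel) ?H"
    using radial_lift_facts(5)[OF f] by (simp add: lborel_prod)
  have AEk: "AE k in lborel. k \<noteq> 0 \<and> integrable lborel (\<lambda>w. ?H (k, w))"
    using lborel_pair.AE_integrable_fst'[OF H] AE_lborel_singleton[of "0::'a"] by eventually_elim simp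
  have J: "integrable (lborel \<Otimes>\<^sub>M lborel) (\<lambda>(k, v). ?J k v)"
  proof (rule lborel_pair.Fubini_integrable)
    show Jm [measurable]: "(\<lambda>(k, v). ?J k v) \<in> borel_measurable (lborel \<Otimes>\<^sub>M lborel)"
      unfolding backprojection_kernel_def by measurable
    show "AE k in lborel. integrable lborel (\<lambda>v. case (k, v) of (k, v) \<Rightarrow> ?J k v)"
      using AEk by eventually_elim (use kernel_substitution(1)[OF f y _ e] in simp)
    have "integrable lborel (\<lambda>k. LINT w|lborel. norm (?H (k, w)))"
      by (rule lborel_pair.integrable_fst'[OF integrable_norm[OF H]])
    then have I: "integrable lborel (\<lambda>k. y ^ DIM('a) * (LINT w|lborel. norm (?H (k, w))))"
      by (rule integrable_mult_right)
    show "integrable lborel (\<lambda>k. LINT v|lborel. norm (case (k, v) of (k, v) \<Rightarrow> ?J k v))"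
    proof (rule integrable_cong_AE_imp[OF I])
      show "AE k in lborel. y ^ DIM('a) * (LINT w|lborel. norm (?H (k, w))) = (LINT v|lborel. norm (case (k, v) of (k, v) \<Rightarrow> ?J k v))"
        using AEk by eventually_elim (use kernel_substitution(2)[OF f y _ e] in simp)
      show "(\<lambda>k. LINT v|lborel. norm (case (k, v) of (k, v) \<Rightarrow> ?J k v)) \<in> borel_measurable lborel"
        using Jm by measurable
    qed
  qed
  show "integrable lborel (\<lambda>v. LINT k|lborel. ?J k v)"
    by (rule lborel_pair.integrable_snd[OF J])
  have "(LINT v|lborel. LINT k|lborel. ?J k v) = (LINT k|lborel. LINT v|lborel. ?J k v)"
    by (rule lborel_pair.Fubini_integral[OF J])
  also have "\<dots> = (LINT k|lborel. complex_of_real (y ^ DIM('a)) *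
      (LINT w|lborel. cis ((k, w) \<bullet> (x, y *\<^sub>R e)) * ?H (k, w)))"
  proof (rule integral_cong_AE)
    show "(\<lambda>k. LINT v|lborel. ?J k v) \<in> borel_measurable lborel"
      using lborel_pair.integrable_fst[OF J] by simp
    show "(\<lambda>k. complex_of_real (y ^ DIM('a)) *
      (LINT w|lborel. cis ((k, w) \<bullet> (x, y *\<^sub>R e)) * ?H (k, w))) \<in> borel_measurable lborel"
      by simp
    show "AE k in lborel. (LINT v|lborel. ?J k v) = complex_of_real (y ^ DIM('a)) *
      (LINT w|lborel. cis ((k, w) \<bullet> (x, y *\<^sub>R e)) * ?H (k, w))"
      using AEk by eventually_elim (use kernel_substitution(3)[OF f y _ e] in simp)
  qed
  also have "\<dots> = complex_of_real (y ^ DIM('a)) *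
      (LINT k|lborel. LINT w|lborel. cis ((k, w) \<bullet> (x, y *\<^sub>R e)) * ?H (k, w))"
    by (rule integral_mult_right_zero)
  also have "(LINT k|lborel. LINT w|lborel. cis ((k, w) \<bullet> (x, y *\<^sub>R e)) * ?H (k, w))
      = (LINT z|lborel. cis (z \<bullet> (x, y *\<^sub>R e)) * ?H z)"
  proof -
    have "integrable (lborel \<Otimes>\<^sub>M lborel) (\<lambda>z. cis (z \<bullet> (x, y *\<^sub>R e)) * ?H z)"
      unfolding lborel_prod by (intro integrable_cis_mult radial_lift_facts(5)[OF f]) measurable
    from lborel_pair.integral_fst'[OF this] show ?thesis by (simp only: lborel_prod)
  qed
  also have "\<dots> = complex_of_real ((2 * pi) ^ DIM('a \<times> 'a)) * complex_of_real (radial_lift p f (x, y *\<^sub>R e))"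
  proof -
    obtain R where R: "\<And>z. radial_lift p f z \<noteq> 0 \<Longrightarrow> norm z \<le> R"
      using radial_lifts_bounded_support[OF radial_lift_in_radial_lifts[OF f, of p]] by blast
    obtain M where "\<And>z. norm (radial_lift p f z) \<le> M"
      using bounded_support_integrable(2)[OF radial_lift_facts(1)[OF f, of p] R] by blast
    then show ?thesis
      using radial_lift_facts[OF f, of p]
      by (intro fourier_inversion[where M=M]) (auto intro!: continuous_intros)
  qed
  also have "radial_lift p f (x, y *\<^sub>R e) = f (x, y) * y powr (- p)"
    using y e by (simp add: radial_lift_def)
  finally show "(LINT v|lborel. LINT k|lborel. ?J k v)
      = complex_of_real (y ^ DIM('a) * y powr (- p) * ((2 * pi) ^ DIM('a) * (2 * pi) ^ DIM('a))) * complex_of_real (f (x, y))"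
    by (simp add: power_add mult_ac)
qed

text \<open>
  The integrand of the second inversion formula after the shift \<open>u = x + v\<close>.
\<close>

definition backprojection_integrand ::
    "real \<Rightarrow> ('a::euclidean_space \<times> real \<Rightarrow> real) \<Rightarrow> 'a \<Rightarrow> real \<Rightarrow> 'a \<Rightarrow> complex" where
  "backprojection_integrand p f x y v =
    complex_of_real (((norm v)\<^sup>2 + y\<^sup>2) powr ((p - 1) / 2) / norm v ^ (DIM('a) - 1)) *
      riesz_conical p f (x + v) (arctan (norm v / y))"

text \<open>
  The weight of the back projection cancels the power of \<open>cos \<theta>\<close> in the transform of the data,
  because \<open>cos (arctan (r / y)) = y / sqrt (r\<^sup>2 + y\<^sup>2)\<close>.
\<close>

lemma cos_arctan_powr:
  assumes y: "y > 0" and "r \<ge> 0"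
  shows "(r\<^sup>2 + y\<^sup>2) powr (q / 2) * cos (arctan (r / y)) powr q = y powr q"
proof -
  have pos: "r\<^sup>2 + y\<^sup>2 > 0" using y by (simp add: add_nonneg_pos)
  have "1 + (r / y)\<^sup>2 = (r\<^sup>2 + y\<^sup>2) / y\<^sup>2" using y by (simp add: power_divide field_simps)
  then have "cos (arctan (r / y)) = y / sqrt (r\<^sup>2 + y\<^sup>2)"
    using y by (simp add: cos_arctan real_sqrt_divide)
  also have "sqrt (r\<^sup>2 + y\<^sup>2) = (r\<^sup>2 + y\<^sup>2) powr (1 / 2)" using pos by (simp add: powr_half_sqrt)
  finally show ?thesis
    using y pos by (simp add: powr_divide powr_powr)
qed

lemma backprojection_integrand_eq_kernel_integral:
  fixes v :: "'a::euclidean_space"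
  assumes f: "f \<in> Cc_infinity_upper" and y: "y > 0" and v: "v \<noteq> 0"
  shows "backprojection_integrand p f x y v
    = complex_of_real (y powr p / (y ^ DIM('a) * (2 * pi) ^ DIM('a))) * (LINT k|lborel. backprojection_kernel p f x y k v)"
proof -
  define m where "m = DIM('a) - 1"
  have m: "DIM('a) = Suc m" by (simp add: m_def)
  define r where "r = norm v"
  have r: "r > 0" using v by (simp add: r_def)
  define \<theta> where "\<theta> = arctan (r / y)"
  have \<theta>: "\<theta> \<in> {0<..<pi/2}" using r y arctan_ubound[of "r / y"] by (simp add: \<theta>_def)
  have t: "tan \<theta> = r / y" by (simp add: \<theta>_def tan_arctan)
  have "((r\<^sup>2 + y\<^sup>2) powr ((p - 1) / 2) / r ^ m) * (cos \<theta> powr (p - 1) * (r / y) ^ m / (2 * pi) ^ DIM('a))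
      = ((r\<^sup>2 + y\<^sup>2) powr ((p - 1) / 2) * cos \<theta> powr (p - 1)) / (y ^ m * (2 * pi) ^ DIM('a))"
    using r by (simp add: power_divide)
  also have "\<dots> = y powr (p - 1) / (y ^ m * (2 * pi) ^ DIM('a))"
    unfolding \<theta>_def using y r by (simp only: cos_arctan_powr[OF y] less_imp_le)
  also have "\<dots> = y powr p / (y ^ DIM('a) * (2 * pi) ^ DIM('a))"
    using y by (simp add: m powr_diff field_simps)
  finally have c: "((r\<^sup>2 + y\<^sup>2) powr ((p - 1) / 2) / r ^ m) * (cos \<theta> powr (p - 1) * (r / y) ^ m / (2 * pi) ^ DIM('a))
      = y powr p / (y ^ DIM('a) * (2 * pi) ^ DIM('a))" .
  show ?thesis
    unfolding backprojection_integrand_def r_def[symmetric] \<theta>_def[symmetric] riesz_conical_eq[OF f \<theta>] t m_def[symmetric]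
      mult.assoc[symmetric] of_real_mult[symmetric] c
    unfolding backprojection_kernel_def r_def by (simp only: mult.assoc)
qed

text \<open>
  The kernel integral represents the integrand only for \<open>v \<noteq> 0\<close>; at \<open>v = 0\<close> the angle
  is 0 and the formula for the transform does not apply, but a single point is a null set.
\<close>

lemma backprojection_integrand_integral:
  fixes f :: "'a::euclidean_space \<times> real \<Rightarrow> real"
  assumes f: "f \<in> Cc_infinity_upper" and y: "y > 0"
  shows "integrable lborel (backprojection_integrand p f x y)"
    and "(LINT v|lborel. backprojection_integrand p f x y v) = complex_of_real ((2 * pi) ^ DIM('a)) * complex_of_real (f (x, y))"
proof -
  let ?c = "complex_of_real (y powr p / (y ^ DIM('a) * (2 * pi) ^ DIM('a)))"
  let ?K = "\<lambda>v. ?c * (LINT k|lborel. backprojection_kernel p f x y k v)"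
  have null: "emeasure lborel {0::'a} = 0" by simp
  have eq: "?K v = backprojection_integrand p f x y v" if "v \<notin> {0}" for v
    using backprojection_integrand_eq_kernel_integral[OF f y, of v] that by simp
  have "integrable lborel ?K"
    by (intro integrable_mult_right kernel_integral(1)[OF f y])
  then show "integrable lborel (backprojection_integrand p f x y)"
    using integrable_discrete_difference[of "{0}" lborel ?K "backprojection_integrand p f x y"] eq null by simp
  have "(LINT v|lborel. backprojection_integrand p f x y v) = (LINT v|lborel. ?K v)"
    using integral_discrete_difference[of "{0}" lborel ?K "backprojection_integrand p f x y"] eq null by simp
  also have "\<dots> = ?c * (complex_of_real (y ^ DIM('a) * y powr (- p) * ((2 * pi) ^ DIM('a) * (2 * pi) ^ DIM('a))) * complex_of_real (f (x, y)))"
    by (subst integral_mult_right_zero, subst kernel_integral(2)[OF f y]) (rule refl)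
  also have "\<dots> = complex_of_real ((y powr p / (y ^ DIM('a) * (2 * pi) ^ DIM('a))) *
      (y ^ DIM('a) * y powr (- p) * ((2 * pi) ^ DIM('a) * (2 * pi) ^ DIM('a)))) * complex_of_real (f (x, y))"
    by (simp only: of_real_mult mult.assoc)
  also have "(y powr p / (y ^ DIM('a) * (2 * pi) ^ DIM('a))) *
      (y ^ DIM('a) * y powr (- p) * ((2 * pi) ^ DIM('a) * (2 * pi) ^ DIM('a))) = (2 * pi) ^ DIM('a)"
    using y by (simp add: powr_minus field_simps)
  finally show "(LINT v|lborel. backprojection_integrand p f x y v)
      = complex_of_real ((2 * pi) ^ DIM('a)) * complex_of_real (f (x, y))" .
qed

text \<open>
  With \<open>r = y tan \<theta>\<close> the factor \<open>r\<^sup>m\<^sup>-\<^sup>1\<close> from polar coordinates cancels the denominator of the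
  weight, and \<open>dr = y / cos\<^sup>2 \<theta> d\<theta>\<close> supplies the remaining powers of \<open>cos \<theta>\<close>.
\<close>

lemma backprojection_integrand_polar:
  fixes f :: "'a::euclidean_space \<times> real \<Rightarrow> real"
  assumes f: "f \<in> Cc_infinity_upper" and y: "y > 0" and \<theta>: "\<theta> \<in> {0<..<pi/2}"
  shows "(y / (cos \<theta>)\<^sup>2) *\<^sub>R ((y * tan \<theta>) ^ (DIM('a) - 1) *\<^sub>R
      (LINT n|sphere_measure. backprojection_integrand p f x y ((y * tan \<theta>) *\<^sub>R n)))
    = complex_of_real (y powr p) * (complex_of_real (1 / cos \<theta> powr (1 + p)) *
      (LINT n|sphere_measure. riesz_conical p f (x + (y * tan \<theta>) *\<^sub>R n) \<theta>))"
proof -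
  define m where "m = DIM('a) - 1"
  define r where "r = y * tan \<theta>"
  have t: "tan \<theta> > 0" using \<theta> by (auto intro: tan_gt_zero)
  have c: "cos \<theta> > 0" using \<theta> by (auto intro: cos_gt_zero_pi)
  have r: "r > 0" using t y by (simp add: r_def)
  have at: "arctan (r / y) = \<theta>" using y \<theta> by (simp add: r_def arctan_tan)
  let ?w = "(r\<^sup>2 + y\<^sup>2) powr ((p - 1) / 2) / r ^ m"
  have [measurable]: "backprojection_integrand p f x y \<in> borel_measurable borel"
    using backprojection_integrand_integral(1)[OF f y] by simp
  have ir: "integrable sphere_measure (\<lambda>n. riesz_conical p f (x + r *\<^sub>R n) \<theta>)"
    unfolding riesz_conical_def by (rule integrable_riesz_potential_sphere)
  have "(LINT n|sphere_measure. backprojection_integrand p f x y (r *\<^sub>R n))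
      = (LINT n|sphere_measure. complex_of_real ?w * riesz_conical p f (x + r *\<^sub>R n) \<theta>)"
  proof (rule integral_cong_AE)
    show "(\<lambda>n. backprojection_integrand p f x y (r *\<^sub>R n)) \<in> borel_measurable sphere_measure" by measurable
    show "(\<lambda>n. complex_of_real ?w * riesz_conical p f (x + r *\<^sub>R n) \<theta>) \<in> borel_measurable sphere_measure"
      using ir by (intro borel_measurable_times) auto
    show "AE n in sphere_measure. backprojection_integrand p f x y (r *\<^sub>R n) = complex_of_real ?w * riesz_conical p f (x + r *\<^sub>R n) \<theta>"
      using AE_sphere_measure_norm
    proof eventually_elim
      case (elim n)
      then have "norm (r *\<^sub>R n) = r" using r by simp
      then show ?case unfolding backprojection_integrand_def m_def[symmetric] by (simp only: at)
    qed
  qed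
  also have "\<dots> = complex_of_real ?w * (LINT n|sphere_measure. riesz_conical p f (x + r *\<^sub>R n) \<theta>)"
    by (rule integral_mult_right_zero)
  finally have 1: "(LINT n|sphere_measure. backprojection_integrand p f x y (r *\<^sub>R n))
      = complex_of_real ?w * (LINT n|sphere_measure. riesz_conical p f (x + r *\<^sub>R n) \<theta>)" .
  have "(y / (cos \<theta>)\<^sup>2) * (r ^ m * ?w) = y / (cos \<theta>)\<^sup>2 * ((r\<^sup>2 + y\<^sup>2) powr ((p - 1) / 2))"
    using r by simp
  also have "\<dots> = y / (cos \<theta>)\<^sup>2 * (y powr (p - 1) / cos \<theta> powr (p - 1))"
  proof -
    have "(r\<^sup>2 + y\<^sup>2) powr ((p - 1) / 2) = y powr (p - 1) / cos \<theta> powr (p - 1)"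
      using cos_arctan_powr[OF y less_imp_le[OF r], of "p - 1"] c unfolding at by (simp add: field_simps)
    then show ?thesis by (simp only:)
  qed
  also have "y / (cos \<theta>)\<^sup>2 * (y powr (p - 1) / cos \<theta> powr (p - 1)) = y powr p * (1 / cos \<theta> powr (1 + p))"
    using y c by (simp add: powr_diff powr_add field_simps power2_eq_square)
  finally have 2: "(y / (cos \<theta>)\<^sup>2) * (r ^ m * ?w) = y powr p * (1 / cos \<theta> powr (1 + p))" .
  show ?thesis
    unfolding r_def[symmetric] m_def[symmetric] 1 scaleR_conv_of_real mult.assoc[symmetric] of_real_mult[symmetric]
    using 2 by (simp only: mult.assoc)
qed

text \<open>
  The second formula is the integral of the shifted integrand; the first is the same
  integral in polar coordinates around \<open>x\<close> with \<open>r = y tan \<theta>\<close>.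
\<close>

theorem theorem1p1:
  fixes d :: nat and p :: real and f :: "'a::euclidean_space \<times> real \<Rightarrow> real"
    and x :: 'a and y :: real
  assumes "d \<ge> 2" and "DIM('a) = d - 1"
    and "f \<in> Cc_infinity_upper" and "y > 0"
  shows
    "((\<forall>\<theta>\<in>{0<..<pi/2}. integrable sphere_measure (\<lambda>n. riesz_conical p f (x + (y * tan \<theta>) *\<^sub>R n) \<theta>)) \<and>
     set_integrable lborel {0<..<pi/2}
       (\<lambda>\<theta>. complex_of_real (1 / (cos \<theta>) powr (1 + p)) *
             (LINT n|sphere_measure. riesz_conical p f (x + (y * tan \<theta>) *\<^sub>R n) \<theta>)) \<and>
     complex_of_real (f (x, y)) =
       complex_of_real (y powr p / (2 * pi) ^ (d - 1)) *
       (LINT \<theta>:{0<..<pi/2}|lborel. complex_of_real (1 / (cos \<theta>) powr (1 + p)) *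
          (LINT n|sphere_measure. riesz_conical p f (x + (y * tan \<theta>) *\<^sub>R n) \<theta>))) \<and>
     (integrable lborel
       (\<lambda>u. complex_of_real (((norm (u - x))\<^sup>2 + y\<^sup>2) powr ((p - 1) / 2) / norm (u - x) ^ (d - 2)) *
             riesz_conical p f u (arctan (norm (u - x) / y))) \<and>
     complex_of_real (f (x, y)) =
       complex_of_real (1 / (2 * pi) ^ (d - 1)) *
       (LINT u|lborel.
          complex_of_real (((norm (u - x))\<^sup>2 + y\<^sup>2) powr ((p - 1) / 2) / norm (u - x) ^ (d - 2)) *
          riesz_conical p f u (arctan (norm (u - x) / y))))"
proof -
  note f = assms(3) and y = assms(4)
  let ?Q = "backprojection_integrand p f x y"
  let ?N = "(2 * pi) ^ (d - 1) :: real"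
  let ?S = "{0<..<pi/2}"
  let ?\<Phi> = "\<lambda>\<theta>. complex_of_real (1 / (cos \<theta>) powr (1 + p)) *
             (LINT n|sphere_measure. riesz_conical p f (x + (y * tan \<theta>) *\<^sub>R n) \<theta>)"
  have d: "d - 2 = DIM('a) - 1" using assms(2) by simp
  have N: "complex_of_real (1 / ?N) * (complex_of_real ?N * c) = c" for c
    by (subst mult.assoc[symmetric], subst of_real_mult[symmetric]) simp
  have Qint: "integrable lborel ?Q"
    and Qval: "(LINT v|lborel. ?Q v) = complex_of_real ?N * complex_of_real (f (x, y))"
    using backprojection_integrand_integral[OF f y, of p x] assms(2) by simp_all
  have [measurable]: "?Q \<in> borel_measurable borel" using Qint by simp

  have u_eq: "(\<lambda>u. complex_of_real (((norm (u - x))\<^sup>2 + y\<^sup>2) powr ((p - 1) / 2) / norm (u - x) ^ (d - 2)) *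
             riesz_conical p f u (arctan (norm (u - x) / y))) = (\<lambda>u. ?Q (- x + 1 *\<^sub>R u))"
    by (simp add: backprojection_integrand_def d fun_eq_iff)
  have 3: "integrable lborel (\<lambda>u. ?Q (- x + 1 *\<^sub>R u))"
    by (subst lborel_integral_affine(1)) (use Qint in auto)
  have Qshift: "(LINT v|lborel. ?Q v) = (LINT u|lborel. ?Q (- x + 1 *\<^sub>R u))"
    using lborel_integral_affine(2)[of ?Q 1 "- x"] by simp
  have 4: "complex_of_real (f (x, y)) = complex_of_real (1 / ?N) * (LINT u|lborel. ?Q (- x + 1 *\<^sub>R u))"
    unfolding Qshift[symmetric] Qval N ..

  have 1: "integrable sphere_measure (\<lambda>n. riesz_conical p f (x + (y * tan \<theta>) *\<^sub>R n) \<theta>)" for \<theta>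
    unfolding riesz_conical_def by (rule integrable_riesz_potential_sphere)
  note P = polar_coordinates[OF Qint]
  note T = set_lborel_integral_substitution_tan[OF y P(1)]
  have "set_integrable lborel ?S (\<lambda>\<theta>. complex_of_real (y powr p) * ?\<Phi> \<theta>)"
    using T(1) by (subst (asm) set_integrable_cong[OF refl refl backprojection_integrand_polar[OF f y]])
  then have "set_integrable lborel ?S (\<lambda>\<theta>. complex_of_real (1 / y powr p) * (complex_of_real (y powr p) * ?\<Phi> \<theta>))"
    by (rule set_integrable_mult_right)
  then have 2: "set_integrable lborel ?S ?\<Phi>" using y by simp
  have "complex_of_real ?N * complex_of_real (f (x, y)) = (LINT \<theta>:?S|lborel. complex_of_real (y powr p) * ?\<Phi> \<theta>)"
    unfolding Qval[symmetric] P(2) T(2)[symmetric]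
    by (rule set_lebesgue_integral_cong) (use backprojection_integrand_polar[OF f y] in auto)
  also have "\<dots> = complex_of_real (y powr p) * (LINT \<theta>:?S|lborel. ?\<Phi> \<theta>)"
    by (rule set_integral_mult_right)
  finally have "complex_of_real (f (x, y)) = complex_of_real (1 / ?N) * (complex_of_real (y powr p) * (LINT \<theta>:?S|lborel. ?\<Phi> \<theta>))"
    using N[of "complex_of_real (f (x, y))"] by (simp only:)
  then have 5: "complex_of_real (f (x, y)) = complex_of_real (y powr p / ?N) * (LINT \<theta>:?S|lborel. ?\<Phi> \<theta>)"
    by (simp only: mult.assoc[symmetric] of_real_mult[symmetric]) simp
  show ?thesis
    unfolding u_eq using 1 2 3 4 5 by blast
qed

end
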